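(* Let $\mathcal X$ be a Polish space, $d$ a lower semicontinuous metric on $\mathcal X$, and $\mu\in\mathcal P_d(\mathcal X)$. (1) Suppose that $a\ge0$ satisfies $\int_{\mathcal X}e^{a\,d(x_o,x)}\,\mu(dx)\le2$ for some $x_o\in\mathcal X$ and that $\gamma\in\mathcal C$ satisfies $\int_{\mathcal X}e^{\gamma(d(x_1,x))}\,\mu(dx)\le B<\infty$ for some $x_1\in\mathcal X$. Then the function $$\alpha(t)=\max\Big((\sqrt{at+1}-1)^2,\ 2\gamma(t/2)-2\log B\Big),\quad t\ge0,$$ satisfies $$\alpha(\mathcal T_d(\mu,\nu))\le H(\nu\mid\mu)\quad\forall\nu\in\mathcal P_d(\mathcal X).\qquad(\ast)$$ (2) Conversely, if a function $\alpha$ in the class $\mathcal C$ satisfies $(\ast)$, then $$\int_{\mathcal X}\exp[u\,\alpha(d(x_*,x)/2)]\,\mu(dx)<\infty$$ for all $x_*\in\mathcal X$ and all $0\le u<2$.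
   Context: $\mathcal P(\mathcal X)$ is the set of Borel probability measures on $\mathcal X$; $\mathcal P_d(\mathcal X)=\{\nu\in\mathcal P(\mathcal X):\int d(x_*,x)\,\nu(dx)<\infty\text{ for some (and therefore all) }x_*\in\mathcal X\}$. The metric $d$ is lower semicontinuous on $\mathcal X\times\mathcal X$ for the Polish topology. $\mathcal T_d(\mu,\nu)=\inf_\pi\int d(x,y)\,\pi(dx\,dy)$, the infimum over all probability measures $\pi$ on $\mathcal X\times\mathcal X$ with first marginal $\mu$ and second marginal $\nu$. $H(\nu\mid\mu)=\int\log\frac{d\nu}{d\mu}\,d\nu$ if $\nu\ll\mu$ and $+\infty$ otherwise. $\mathcal C$ is the class of all functions on $[0,\infty)$, with values in $[0,\infty]$ (the value $+\infty$ is allowed), that are convex, increasing (meaning nondecreasing), left continuous, and vanish at $0$.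
   Formalization: In (2) the conclusion is proved for those x_* with α(∫d(x_*,x)μ(dx)) < ∞ (automatic if α is finite-valued); without this it fails, e.g. for μ=δ_0 on the real line, α(0)=0 and α=+∞ on (0,∞), x_*=1, u=1. *)

theory Defs
  imports "HOL-Probability.Probability"
begin

definition lsc_metric :: "('a::topological_space \<Rightarrow> 'a \<Rightarrow> real) \<Rightarrow> bool" where
  "lsc_metric d \<longleftrightarrow> Metric_space UNIV d \<and> (\<forall>c. open {p :: 'a \<times> 'a. c < d (fst p) (snd p)})"

definition borel_probs :: "'a::topological_space measure set" where
  "borel_probs = {\<nu>. prob_space \<nu> \<and> sets \<nu> = sets borel}"

definition borel_probs_d :: "('a::topological_space \<Rightarrow> 'a \<Rightarrow> real) \<Rightarrow> 'a measure set" where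
  "borel_probs_d d = {\<nu> \<in> borel_probs. \<exists>x0. (\<integral>\<^sup>+ x. ennreal (d x0 x) \<partial>\<nu>) < \<infinity>}"

definition couplings ::
  "'a::topological_space measure \<Rightarrow> 'a measure \<Rightarrow> ('a \<times> 'a) measure set" where
  "couplings \<mu> \<nu> = {\<pi> \<in> borel_probs. distr \<pi> borel fst = \<mu> \<and> distr \<pi> borel snd = \<nu>}"

definition transport_cost ::
  "('a::topological_space \<Rightarrow> 'a \<Rightarrow> real) \<Rightarrow> 'a measure \<Rightarrow> 'a measure \<Rightarrow> ennreal" where
  "transport_cost d \<mu> \<nu> = (INF \<pi>\<in>couplings \<mu> \<nu>. \<integral>\<^sup>+ p. ennreal (d (fst p) (snd p)) \<partial>\<pi>)"

(* The argument order is that of H(nu | mu) = rel_entropy nu mu.  The integral of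
   log(dnu/dmu) against nu is taken as positive part minus negative part, so that it can be
   infinite; the negative part is always finite.  (The library's KL_divergence is a Bochner
   integral, which is 0 when the logarithm is not integrable.) *)
definition rel_entropy :: "'a measure \<Rightarrow> 'a measure \<Rightarrow> ereal" where
  "rel_entropy \<nu> \<mu> =
    (if absolutely_continuous \<mu> \<nu>
     then enn2ereal (\<integral>\<^sup>+ x. ennreal (ln (enn2real (RN_deriv \<mu> \<nu> x))) \<partial>\<nu>)
        - enn2ereal (\<integral>\<^sup>+ x. ennreal (- ln (enn2real (RN_deriv \<mu> \<nu> x))) \<partial>\<nu>)
     else \<infinity>)"

(* Functions on [0,\<infinity>) are functions on the reals whose values at negative arguments are
   irrelevant; hence left continuity is only required at t > 0. *)
definition class_C :: "(real \<Rightarrow> ereal) set" where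
  "class_C = {\<alpha>.
     (\<forall>t\<ge>0. 0 \<le> \<alpha> t) \<and> \<alpha> 0 = 0 \<and> mono_on {0..} \<alpha> \<and>
     (\<forall>s\<ge>0. \<forall>t\<ge>0. \<forall>l\<in>{0..1}.
        \<alpha> ((1 - l) * s + l * t) \<le> ereal (1 - l) * \<alpha> s + ereal l * \<alpha> t) \<and>
     (\<forall>t>0. (\<alpha> \<longlongrightarrow> \<alpha> t) (at_left t))}"

definition exp_ext :: "ereal \<Rightarrow> ennreal" where
  "exp_ext x = (case x of ereal r \<Rightarrow> ennreal (exp r) | PInfty \<Rightarrow> \<infinity> | MInfty \<Rightarrow> 0)"

(* The transport cost between two members of borel_probs_d d is finite, so enn2real loses
   nothing here. *)
definition transport_entropy_ineq ::
  "('a::topological_space \<Rightarrow> 'a \<Rightarrow> real) \<Rightarrow> 'a measure \<Rightarrow> (real \<Rightarrow> ereal) \<Rightarrow> bool" where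
  "transport_entropy_ineq d \<mu> \<alpha> \<longleftrightarrow>
     (\<forall>\<nu>\<in>borel_probs_d d. \<alpha> (enn2real (transport_cost d \<mu> \<nu>)) \<le> rel_entropy \<nu> \<mu>)"

end

theory Submission
  imports Defs
begin

text \<open>
  Both directions compare the relative entropy with integrals against \<open>\<nu>\<close>.  The first direction
  uses Gibbs' variational inequality \<open>\<integral>\<phi> d\<nu> \<le> H(\<nu> | \<mu>) + ln \<integral>exp \<phi> d\<mu>\<close>
  (\<open>gibbs_variational_inequality\<close>) together with explicit couplings as upper bounds for the
  transport cost \<open>T\<close>; the second tests the transport inequality on conditioned measures.

  For the quadratic-linear bound, \<open>T\<close> is at most \<open>\<integral>\<bar>g - 1\<bar> * d z d\<mu>\<close> where \<open>g\<close> is the density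
  of \<open>\<nu>\<close> (\<open>transport_cost_le_weighted_variation\<close>): leave the common mass in place and move the
  rest through \<open>z\<close>.  This is the difference of the \<open>\<nu>\<close>- and \<open>\<mu>\<close>-integrals of a function of
  absolute value \<open>d z\<close>, and a Bernstein estimate for its Laplace transform gives
  \<open>r * a * T \<le> H + r\<^sup>2\<close> for \<open>0 \<le> r \<le> 1\<close> (\<open>weighted_variation_entropy_bound\<close>).  Optimizing over
  \<open>r\<close> yields \<open>a * T \<le> H + 2 * sqrt H\<close>.

  For the bound in terms of \<open>\<gamma>\<close>, the product coupling shows that \<open>T\<close> is at most the sum of the mean
  distances to \<open>z\<close> under \<open>\<mu>\<close> and \<open>\<nu>\<close>.  For an affine minorant of \<open>\<gamma>\<close> the claim is then two
  instances of Gibbs' inequality, and \<open>\<gamma>\<close> is the supremum of such minorants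
  (\<open>class_C_affine_minorant\<close>).

  For the converse, let \<open>m\<close> be the mean distance to \<open>z\<close> under \<open>\<mu>\<close>.  Conditioning \<open>\<mu>\<close> on the event
  \<open>\<alpha> (max 0 (d z x - m)) > r\<close> moves the mean distance to \<open>z\<close> far enough, and costs only the entropy
  \<open>- ln\<close> of the probability of the event, so that this probability is at most \<open>exp (- r)\<close>
  (\<open>transport_inequality_imp_deviation\<close>).  Hence \<open>\<alpha> (max 0 (d z x - m))\<close> has exponential moments of
  every order below 1.  Convexity of \<open>\<alpha>\<close> at a midpoint trades the shift by \<open>m\<close> for the factors
  \<open>1/2\<close>, which doubles the admissible range of \<open>u\<close>.
\<close>

section \<open>Lower semicontinuous metrics\<close>

lemma lsc_metric_nonneg: "lsc_metric d \<Longrightarrow> 0 \<le> d x y"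
  by (simp add: lsc_metric_def Metric_space_def)

lemma lsc_metric_commute: "lsc_metric d \<Longrightarrow> d x y = d y x"
  by (simp add: lsc_metric_def Metric_space_def)

lemma lsc_metric_triangle: "lsc_metric d \<Longrightarrow> d x y \<le> d x z + d z y"
  unfolding lsc_metric_def Metric_space_def by blast

lemma lsc_metric_measurable_pair:
  fixes d :: "'a::polish_space \<Rightarrow> 'a \<Rightarrow> real"
  assumes "lsc_metric d"
  shows "(\<lambda>p. d (fst p) (snd p)) \<in> borel_measurable (borel \<Otimes>\<^sub>M borel)"
  unfolding borel_prod
  by (rule borel_measurableI_greater) (use assms in \<open>auto simp: lsc_metric_def\<close>)

lemma lsc_metric_measurable:
  fixes d :: "'a::polish_space \<Rightarrow> 'a \<Rightarrow> real"
  assumes "lsc_metric d"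
  shows "d x \<in> borel_measurable borel"
proof -
  have "(\<lambda>y. (x, y)) \<in> borel \<rightarrow>\<^sub>M borel \<Otimes>\<^sub>M borel" by measurable
  from measurable_compose[OF this lsc_metric_measurable_pair[OF assms]]
  show ?thesis by simp
qed

section \<open>Upper and lower bounds for the transport cost\<close>

text \<open>
  If \<open>\<nu>\<close> arises from \<open>\<mu>\<close> by keeping a point \<open>x\<close> with probability \<open>p x\<close> and otherwise
  redrawing it from \<open>\<rho>\<close>, then the pair (old point, new point) is a coupling of \<open>\<mu>\<close> and \<open>\<nu>\<close>, and
  only redrawn points have to travel.  The coin that decides between keeping and redrawing is
  carried as a third, boolean coordinate, and its bias is put into a density, which makes the
  coupling a push-forward of a product measure.
\<close>

lemma transport_cost_le_mixture:
  fixes d :: "'a::polish_space \<Rightarrow> 'a \<Rightarrow> real" and p :: "'a \<Rightarrow> real"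
  assumes d: "lsc_metric d"
    and \<mu>: "\<mu> \<in> borel_probs" and \<rho>: "\<rho> \<in> borel_probs" and \<nu>: "\<nu> \<in> borel_probs"
    and p [measurable]: "p \<in> borel_measurable borel" and p01: "\<And>x. 0 \<le> p x" "\<And>x. p x \<le> 1"
    and mix: "\<And>A. A \<in> sets borel \<Longrightarrow> emeasure \<nu> A =
      (\<integral>\<^sup>+ x. ennreal (p x) * indicator A x \<partial>\<mu>) + (\<integral>\<^sup>+ x. ennreal (1 - p x) \<partial>\<mu>) * emeasure \<rho> A"
  shows "transport_cost d \<mu> \<nu> \<le> (\<integral>\<^sup>+ x. ennreal (1 - p x) * (\<integral>\<^sup>+ y. ennreal (d x y) \<partial>\<rho>) \<partial>\<mu>)"
proof -
  have [measurable_cong]: "sets \<mu> = sets borel" "sets \<rho> = sets borel" "sets \<nu> = sets borel"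
    using \<mu> \<rho> \<nu> by (auto simp: borel_probs_def)
  interpret M: prob_space \<mu> using \<mu> by (simp add: borel_probs_def)
  interpret R: prob_space \<rho> using \<rho> by (simp add: borel_probs_def)
  interpret C: sigma_finite_measure "count_space (UNIV :: bool set)"
    by (rule sigma_finite_measure_count_space_finite) simp
  interpret RC: pair_sigma_finite \<rho> "count_space (UNIV :: bool set)" ..
  define w :: "'a \<times> 'a \<times> bool \<Rightarrow> ennreal"
    where "w = (\<lambda>z. if snd (snd z) then ennreal (p (fst z)) else ennreal (1 - p (fst z)))"
  define F :: "'a \<times> 'a \<times> bool \<Rightarrow> 'a \<times> 'a"
    where "F = (\<lambda>z. (fst z, if snd (snd z) then fst z else fst (snd z)))"
  let ?N = "\<mu> \<Otimes>\<^sub>M (\<rho> \<Otimes>\<^sub>M count_space (UNIV :: bool set))"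
  define \<pi> where "\<pi> = distr (density ?N w) (borel \<Otimes>\<^sub>M borel) F"
  have w [measurable]: "w \<in> borel_measurable ?N" unfolding w_def by measurable
  have F [measurable]: "F \<in> ?N \<rightarrow>\<^sub>M borel \<Otimes>\<^sub>M borel" unfolding F_def by measurable
  have int: "(\<integral>\<^sup>+ z. h z \<partial>\<pi>) =
      (\<integral>\<^sup>+ x. (\<integral>\<^sup>+ y. ennreal (p x) * h (x, x) + ennreal (1 - p x) * h (x, y) \<partial>\<rho>) \<partial>\<mu>)"
    if h [measurable]: "h \<in> borel_measurable (borel \<Otimes>\<^sub>M borel)" for h
  proof -
    have "(\<integral>\<^sup>+ z. h z \<partial>\<pi>) = (\<integral>\<^sup>+ z. w z * h (F z) \<partial>?N)"
      unfolding \<pi>_def by (simp add: nn_integral_distr nn_integral_density)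
    also have "\<dots> = (\<integral>\<^sup>+ x. (\<integral>\<^sup>+ yb. w (x, yb) * h (F (x, yb)) \<partial>(\<rho> \<Otimes>\<^sub>M count_space UNIV)) \<partial>\<mu>)"
      by (rule RC.P.nn_integral_fst[symmetric]) measurable
    also have "\<dots> = (\<integral>\<^sup>+ x. (\<integral>\<^sup>+ y. (\<integral>\<^sup>+ b. w (x, y, b) * h (F (x, y, b)) \<partial>count_space UNIV) \<partial>\<rho>) \<partial>\<mu>)"
      by (intro nn_integral_cong C.nn_integral_fst[symmetric]) measurable
    also have "\<dots> = (\<integral>\<^sup>+ x. (\<integral>\<^sup>+ y. ennreal (p x) * h (x, x) + ennreal (1 - p x) * h (x, y) \<partial>\<rho>) \<partial>\<mu>)"
      by (simp add: nn_integral_count_space_finite UNIV_bool w_def F_def add.commute)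
    finally show ?thesis .
  qed
  have p1: "ennreal (p x) + ennreal (1 - p x) = 1" for x
    using p01[of x] by (simp flip: ennreal_plus)
  have fst: "distr \<pi> borel fst = \<mu>"
  proof (rule measure_eqI)
    fix A assume "A \<in> sets (distr \<pi> borel fst)"
    then have A [measurable]: "A \<in> sets borel" by simp
    have "emeasure (distr \<pi> borel fst) A = (\<integral>\<^sup>+ z. indicator A (fst z) \<partial>\<pi>)"
      by (subst nn_integral_distr[symmetric, where T = fst and M' = borel and f = "indicator A"])
        (auto simp: \<pi>_def)
    also have "\<dots> = emeasure \<mu> A"
      by (subst int, measurable)
        (simp add: R.emeasure_space_1 p1 flip: distrib_right)
    finally show "emeasure (distr \<pi> borel fst) A = emeasure \<mu> A" .
  qed (simp add: \<open>sets \<mu> = sets borel\<close>)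
  have snd: "distr \<pi> borel snd = \<nu>"
  proof (rule measure_eqI)
    fix A assume "A \<in> sets (distr \<pi> borel snd)"
    then have A [measurable]: "A \<in> sets borel" by simp
    have "emeasure (distr \<pi> borel snd) A = (\<integral>\<^sup>+ z. indicator A (snd z) \<partial>\<pi>)"
      by (subst nn_integral_distr[symmetric, where T = snd and M' = borel and f = "indicator A"])
        (auto simp: \<pi>_def)
    also have "\<dots> = (\<integral>\<^sup>+ x. ennreal (p x) * indicator A x + ennreal (1 - p x) * emeasure \<rho> A \<partial>\<mu>)"
      by (subst int, measurable)
        (simp add: R.emeasure_space_1 nn_integral_add nn_integral_cmult)
    also have "\<dots> = emeasure \<nu> A"
      by (simp add: mix nn_integral_add nn_integral_multc)
    finally show "emeasure (distr \<pi> borel snd) A = emeasure \<nu> A" .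
  qed (simp add: \<open>sets \<nu> = sets borel\<close>)
  have "emeasure \<pi> (space \<pi>) = (\<integral>\<^sup>+ z. 1 \<partial>\<pi>)" by simp
  also have "\<dots> = 1" by (subst int) (simp_all add: R.emeasure_space_1 M.emeasure_space_1 p1)
  finally have "prob_space \<pi>" by (rule prob_spaceI)
  then have "\<pi> \<in> couplings \<mu> \<nu>"
    using fst snd by (simp add: couplings_def borel_probs_def \<pi>_def borel_prod)
  then have "transport_cost d \<mu> \<nu> \<le> (\<integral>\<^sup>+ z. ennreal (d (fst z) (snd z)) \<partial>\<pi>)"
    unfolding transport_cost_def by (rule INF_lower)
  also have "\<dots> = (\<integral>\<^sup>+ x. ennreal (1 - p x) * (\<integral>\<^sup>+ y. ennreal (d x y) \<partial>\<rho>) \<partial>\<mu>)"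
  proof -
    note [measurable] = lsc_metric_measurable[OF d] lsc_metric_measurable_pair[OF d]
    have "d x x = 0" for x
      using d by (auto simp: lsc_metric_def Metric_space_def)
    then show ?thesis by (subst int) (simp_all add: nn_integral_cmult)
  qed
  finally show ?thesis .
qed

text \<open>
  A redrawn point is charged for the detour through \<open>z\<close>; the cost then splits into a part that
  depends on the old point and a part that depends on the new one.
\<close>

lemma transport_cost_le_mixture_moments:
  fixes d :: "'a::polish_space \<Rightarrow> 'a \<Rightarrow> real" and p :: "'a \<Rightarrow> real"
  assumes d: "lsc_metric d"
    and \<mu>: "\<mu> \<in> borel_probs" and \<rho>: "\<rho> \<in> borel_probs" and \<nu>: "\<nu> \<in> borel_probs"
    and p [measurable]: "p \<in> borel_measurable borel" and p01: "\<And>x. 0 \<le> p x" "\<And>x. p x \<le> 1"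
    and mix: "\<And>A. A \<in> sets borel \<Longrightarrow> emeasure \<nu> A =
      (\<integral>\<^sup>+ x. ennreal (p x) * indicator A x \<partial>\<mu>) + (\<integral>\<^sup>+ x. ennreal (1 - p x) \<partial>\<mu>) * emeasure \<rho> A"
  shows "transport_cost d \<mu> \<nu> \<le> (\<integral>\<^sup>+ x. ennreal (1 - p x) * ennreal (d z x) \<partial>\<mu>)
    + (\<integral>\<^sup>+ x. ennreal (1 - p x) \<partial>\<mu>) * (\<integral>\<^sup>+ y. ennreal (d z y) \<partial>\<rho>)"
proof -
  have [measurable_cong]: "sets \<mu> = sets borel" "sets \<rho> = sets borel"
    using \<mu> \<rho> by (auto simp: borel_probs_def)
  interpret R: prob_space \<rho> using \<rho> by (simp add: borel_probs_def)
  note [measurable] = lsc_metric_measurable[OF d]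
  have "(\<integral>\<^sup>+ x. ennreal (1 - p x) * (\<integral>\<^sup>+ y. ennreal (d x y) \<partial>\<rho>) \<partial>\<mu>)
      \<le> (\<integral>\<^sup>+ x. ennreal (1 - p x) * (\<integral>\<^sup>+ y. ennreal (d z x) + ennreal (d z y) \<partial>\<rho>) \<partial>\<mu>)"
  proof (intro nn_integral_mono mult_left_mono)
    fix x y
    have "d x y \<le> d z x + d z y" "0 \<le> d z x" "0 \<le> d z y"
      using lsc_metric_triangle[OF d, of x y z] lsc_metric_commute[OF d, of x z]
      by (simp_all add: lsc_metric_nonneg[OF d])
    then show "ennreal (d x y) \<le> ennreal (d z x) + ennreal (d z y)"
      by (simp flip: ennreal_plus add: ennreal_leI)
  qed simp
  also have "\<dots> = (\<integral>\<^sup>+ x. ennreal (1 - p x) * ennreal (d z x) \<partial>\<mu>)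
    + (\<integral>\<^sup>+ x. ennreal (1 - p x) \<partial>\<mu>) * (\<integral>\<^sup>+ y. ennreal (d z y) \<partial>\<rho>)"
    by (simp add: nn_integral_add nn_integral_multc R.emeasure_space_1 distrib_left)
  finally show ?thesis
    using transport_cost_le_mixture[OF d \<mu> \<rho> \<nu> p p01 mix] by (rule order_trans[rotated])
qed

text \<open>
  The case \<open>p = 0\<close>, in which the coupling is the product measure.
\<close>

lemma transport_cost_le_moments:
  fixes d :: "'a::polish_space \<Rightarrow> 'a \<Rightarrow> real"
  assumes "lsc_metric d" "\<mu> \<in> borel_probs" "\<nu> \<in> borel_probs"
  shows "transport_cost d \<mu> \<nu> \<le> (\<integral>\<^sup>+ x. ennreal (d z x) \<partial>\<mu>) + (\<integral>\<^sup>+ y. ennreal (d z y) \<partial>\<nu>)"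
proof -
  interpret M: prob_space \<mu> using assms by (simp add: borel_probs_def)
  show ?thesis
    using transport_cost_le_mixture_moments[OF assms(1,2,3,3), of "\<lambda>_. 0" z]
    by (simp add: M.emeasure_space_1)
qed

text \<open>
  The easy half of Kantorovich duality, for the 1-Lipschitz function \<open>d z\<close>: integrate
  \<open>d z y \<le> d z x + d x y\<close> against an arbitrary coupling.
\<close>

lemma moment_le_transport_cost:
  fixes d :: "'a::polish_space \<Rightarrow> 'a \<Rightarrow> real"
  assumes d: "lsc_metric d" and fin: "(\<integral>\<^sup>+ x. ennreal (d z x) \<partial>\<mu>) \<noteq> \<infinity>"
  shows "(\<integral>\<^sup>+ y. ennreal (d z y) \<partial>\<nu>) \<le> (\<integral>\<^sup>+ x. ennreal (d z x) \<partial>\<mu>) + transport_cost d \<mu> \<nu>"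
proof -
  have "(\<integral>\<^sup>+ y. ennreal (d z y) \<partial>\<nu>) \<le>
      (\<integral>\<^sup>+ x. ennreal (d z x) \<partial>\<mu>) + (\<integral>\<^sup>+ q. ennreal (d (fst q) (snd q)) \<partial>\<pi>)"
    if "\<pi> \<in> couplings \<mu> \<nu>" for \<pi>
  proof -
    have \<mu>: "\<mu> = distr \<pi> borel fst" and \<nu>: "\<nu> = distr \<pi> borel snd"
      using that by (simp_all add: couplings_def)
    have [measurable_cong]: "sets \<pi> = sets (borel \<Otimes>\<^sub>M (borel :: 'a measure))"
      using that unfolding couplings_def borel_probs_def borel_prod by simp
    note [measurable] = lsc_metric_measurable[OF d] lsc_metric_measurable_pair[OF d]
    have "(\<integral>\<^sup>+ y. ennreal (d z y) \<partial>\<nu>) = (\<integral>\<^sup>+ q. ennreal (d z (snd q)) \<partial>\<pi>)"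
      unfolding \<nu> by (rule nn_integral_distr) measurable
    also have "\<dots> \<le> (\<integral>\<^sup>+ q. ennreal (d z (fst q)) + ennreal (d (fst q) (snd q)) \<partial>\<pi>)"
    proof (rule nn_integral_mono)
      fix q
      have "d z (snd q) \<le> d z (fst q) + d (fst q) (snd q)" "0 \<le> d z (fst q)" "0 \<le> d (fst q) (snd q)"
        by (intro lsc_metric_triangle[OF d] lsc_metric_nonneg[OF d])+
      then show "ennreal (d z (snd q)) \<le> ennreal (d z (fst q)) + ennreal (d (fst q) (snd q))"
        by (simp flip: ennreal_plus add: ennreal_leI)
    qed
    also have "\<dots> = (\<integral>\<^sup>+ q. ennreal (d z (fst q)) \<partial>\<pi>) + (\<integral>\<^sup>+ q. ennreal (d (fst q) (snd q)) \<partial>\<pi>)"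
      by (rule nn_integral_add) measurable
    also have "(\<integral>\<^sup>+ q. ennreal (d z (fst q)) \<partial>\<pi>) = (\<integral>\<^sup>+ x. ennreal (d z x) \<partial>\<mu>)"
      unfolding \<mu> by (rule nn_integral_distr[symmetric]) measurable
    finally show ?thesis .
  qed
  then have "(\<integral>\<^sup>+ y. ennreal (d z y) \<partial>\<nu>) - (\<integral>\<^sup>+ x. ennreal (d z x) \<partial>\<mu>) \<le> transport_cost d \<mu> \<nu>"
    unfolding transport_cost_def using fin
    by (intro INF_greatest) (auto simp: ennreal_minus_le_iff)
  then show ?thesis using fin by (auto simp: ennreal_minus_le_iff)
qed

lemma finite_moment:
  fixes d :: "'a::polish_space \<Rightarrow> 'a \<Rightarrow> real"
  assumes d: "lsc_metric d" and \<nu>: "\<nu> \<in> borel_probs_d d"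
  shows "integrable \<nu> (d z)"
proof -
  from \<nu> obtain x0 where x0: "(\<integral>\<^sup>+ x. ennreal (d x0 x) \<partial>\<nu>) < \<infinity>"
    by (auto simp: borel_probs_d_def)
  interpret prob_space \<nu> using \<nu> by (simp add: borel_probs_d_def borel_probs_def)
  have [measurable_cong]: "sets \<nu> = sets borel"
    using \<nu> by (auto simp: borel_probs_d_def borel_probs_def)
  note [measurable] = lsc_metric_measurable[OF d]
  have tri: "d z x \<le> d z x0 + d x0 x" and nn: "0 \<le> d y x" for x y
    by (intro lsc_metric_triangle[OF d] lsc_metric_nonneg[OF d])+
  have "integrable \<nu> (d x0)"
    using x0 by (intro integrableI_nonneg) (auto simp: nn)
  then have "integrable \<nu> (\<lambda>x. d z x0 + d x0 x)" by simp
  then show ?thesis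
    by (rule Bochner_Integration.integrable_bound) (use tri nn in \<open>auto intro: abs_le_D1\<close>)
qed

text \<open>
  Between members of \<^const>\<open>borel_probs_d\<close> all quantities above are finite, and the two bounds
  become inequalities between real numbers.
\<close>

lemma
  fixes d :: "'a::polish_space \<Rightarrow> 'a \<Rightarrow> real"
  assumes d: "lsc_metric d" and \<mu>: "\<mu> \<in> borel_probs_d d" and \<nu>: "\<nu> \<in> borel_probs_d d"
  defines "T \<equiv> transport_cost d \<mu> \<nu>"
  shows transport_cost_le_integrals: "enn2real T \<le> (\<integral>x. d z x \<partial>\<mu>) + (\<integral>x. d z x \<partial>\<nu>)"
    and integral_le_transport_cost: "(\<integral>x. d z x \<partial>\<nu>) \<le> (\<integral>x. d z x \<partial>\<mu>) + enn2real T"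
proof -
  have nn: "0 \<le> d z x" for x
    by (rule lsc_metric_nonneg[OF d])
  have I: "(\<integral>\<^sup>+ x. ennreal (d z x) \<partial>M) = ennreal (\<integral>x. d z x \<partial>M)" if "M \<in> borel_probs_d d" for M
    using finite_moment[OF d that] by (intro nn_integral_eq_integral) (auto simp: nn)
  have J: "0 \<le> (\<integral>x. d z x \<partial>M)" for M
    by (rule integral_nonneg_AE) (simp add: nn)
  have "T \<le> ennreal ((\<integral>x. d z x \<partial>\<mu>) + (\<integral>x. d z x \<partial>\<nu>))"
    using transport_cost_le_moments[OF d, of \<mu> \<nu> z] \<mu> \<nu>
    by (simp add: I J T_def borel_probs_d_def flip: ennreal_plus)
  then show "enn2real T \<le> (\<integral>x. d z x \<partial>\<mu>) + (\<integral>x. d z x \<partial>\<nu>)"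
    by (rule enn2real_leI[OF add_nonneg_nonneg[OF J J]])
  from \<open>T \<le> _\<close> have T: "T = ennreal (enn2real T)"
    by (cases T) (auto simp: top_unique)
  have "ennreal (\<integral>x. d z x \<partial>\<nu>) \<le> ennreal (\<integral>x. d z x \<partial>\<mu>) + T"
    using moment_le_transport_cost[OF d, where z = z and \<mu> = \<mu> and \<nu> = \<nu>]
    by (simp add: I \<mu> \<nu> T_def)
  also have "\<dots> = ennreal ((\<integral>x. d z x \<partial>\<mu>) + enn2real T)"
    by (subst T) (simp add: J ennreal_plus)
  finally show "(\<integral>x. d z x \<partial>\<nu>) \<le> (\<integral>x. d z x \<partial>\<mu>) + enn2real T"
    by (subst (asm) ennreal_le_iff) (auto intro: add_nonneg_nonneg J)
qed

section \<open>Relative entropy\<close>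

text \<open>
  The negative part of \<open>ln g\<close> is always \<open>\<nu>\<close>-integrable since \<open>g * (- ln g) \<le> 1\<close>.  So a finite
  relative entropy is an honest Bochner integral.
\<close>

lemma rel_entropy_finite_density:
  assumes \<mu>: "prob_space \<mu>" and \<nu>: "prob_space \<nu>" and sets: "sets \<nu> = sets \<mu>"
    and H: "rel_entropy \<nu> \<mu> \<noteq> \<infinity>"
  obtains g :: "'a \<Rightarrow> real" where
    "g \<in> borel_measurable \<mu>" "\<And>x. 0 \<le> g x" "\<nu> = density \<mu> (\<lambda>x. ennreal (g x))"
    "integrable \<nu> (\<lambda>x. ln (g x))" "rel_entropy \<nu> \<mu> = ereal (\<integral>x. ln (g x) \<partial>\<nu>)"
proof -
  interpret M: prob_space \<mu> by fact
  interpret N: prob_space \<nu> by fact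
  have [measurable_cong]: "sets \<nu> = sets \<mu>" by fact
  define g where "g x = enn2real (RN_deriv \<mu> \<nu> x)" for x
  have g [measurable]: "g \<in> borel_measurable \<mu>" unfolding g_def by measurable
  have g0: "0 \<le> g x" for x by (simp add: g_def)
  have ac: "absolutely_continuous \<mu> \<nu>"
    using H by (auto simp: rel_entropy_def split: if_splits)
  have dens: "\<nu> = density \<mu> (\<lambda>x. ennreal (g x))"
  proof -
    have "density \<mu> (\<lambda>x. ennreal (g x)) = density \<mu> (RN_deriv \<mu> \<nu>)"
      using M.RN_deriv_finite[OF N.sigma_finite_measure_axioms ac sets]
      by (intro density_cong) (auto simp: g_def less_top)
    then show ?thesis using M.density_RN_deriv[OF ac sets] by simp
  qed
  let ?P = "\<integral>\<^sup>+ x. ennreal (ln (g x)) \<partial>\<nu>" and ?N = "\<integral>\<^sup>+ x. ennreal (- ln (g x)) \<partial>\<nu>"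
  have "?N = (\<integral>\<^sup>+ x. ennreal (g x) * ennreal (- ln (g x)) \<partial>\<mu>)"
    by (subst dens) (rule nn_integral_density; measurable)
  also have "\<dots> \<le> (\<integral>\<^sup>+ x. 1 \<partial>\<mu>)"
  proof (rule nn_integral_mono)
    fix x
    have "g x * (- ln (g x)) \<le> 1"
    proof (cases "g x = 0")
      case False
      then have pos: "0 < g x" using g0[of x] by simp
      then have "- ln (g x) \<le> 1 / g x - 1"
        using ln_le_minus_one[of "1 / g x"] by (simp add: ln_div)
      then have "g x * (- ln (g x)) \<le> g x * (1 / g x - 1)" using pos by (intro mult_left_mono) auto
      also have "\<dots> \<le> 1" using pos by (simp add: field_simps)
      finally show ?thesis .
    qed simp
    then show "ennreal (g x) * ennreal (- ln (g x)) \<le> 1"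
      using g0[of x] by (simp flip: ennreal_mult' add: ennreal_leI flip: ennreal_1)
  qed
  finally have N: "?N \<noteq> \<infinity>"
    using M.emeasure_space_1 by (auto simp: top_unique)
  have eq: "rel_entropy \<nu> \<mu> = enn2ereal ?P - enn2ereal ?N"
    using ac by (simp add: rel_entropy_def g_def)
  have P: "?P \<noteq> \<infinity>"
    using H N unfolding eq by (cases ?P; cases ?N) auto
  have int: "integrable \<nu> (\<lambda>x. ln (g x))"
    using P N by (simp add: real_integrable_def)
  have "rel_entropy \<nu> \<mu> = ereal (\<integral>x. ln (g x) \<partial>\<nu>)"
    unfolding eq real_lebesgue_integral_def[OF int]
    using P N by (cases ?P; cases ?N) (auto simp: enn2ereal_ennreal)
  with that[OF g g0 dens int] show thesis by blast
qed

text \<open>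
  With \<open>h = exp \<phi> / (g * K)\<close>, where \<open>g\<close> is the density of \<open>\<nu>\<close>, one has
  \<open>\<phi> - ln g - ln K = ln h \<le> h - 1\<close>, and the \<open>\<nu>\<close>-integral of \<open>h\<close> is at most 1.
  A bound \<open>K\<close> is used in place of the integral of \<open>exp \<phi>\<close> because the applications only know
  upper bounds for it.
\<close>

lemma gibbs_variational_inequality:
  assumes \<mu>: "prob_space \<mu>" and \<nu>: "prob_space \<nu>" and sets: "sets \<nu> = sets \<mu>"
    and \<phi>: "integrable \<nu> \<phi>"
    and K: "(\<integral>\<^sup>+ x. ennreal (exp (\<phi> x)) \<partial>\<mu>) \<le> ennreal K" "0 < K"
  shows "ereal (\<integral>x. \<phi> x \<partial>\<nu>) \<le> rel_entropy \<nu> \<mu> + ereal (ln K)"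
proof (cases "rel_entropy \<nu> \<mu> = \<infinity>")
  case False
  interpret N: prob_space \<nu> by fact
  from rel_entropy_finite_density[OF \<mu> \<nu> sets False] obtain g where
    g [measurable]: "g \<in> borel_measurable \<mu>" and g0: "\<And>x. 0 \<le> g x"
    and dens: "\<nu> = density \<mu> (\<lambda>x. ennreal (g x))"
    and int: "integrable \<nu> (\<lambda>x. ln (g x))"
    and H: "rel_entropy \<nu> \<mu> = ereal (\<integral>x. ln (g x) \<partial>\<nu>)" by blast
  have [measurable_cong]: "sets \<nu> = sets \<mu>" by fact
  have [measurable]: "\<phi> \<in> borel_measurable \<mu>"
    using borel_measurable_integrable[OF \<phi>] by measurable
  define h where "h x = exp (\<phi> x) / (g x * K)" for x
  have h [measurable]: "h \<in> borel_measurable \<mu>" unfolding h_def by measurable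
  have h0: "0 \<le> h x" for x using g0[of x] K(2) by (simp add: h_def)
  have "(\<integral>\<^sup>+ x. ennreal (h x) \<partial>\<nu>) = (\<integral>\<^sup>+ x. ennreal (g x) * ennreal (h x) \<partial>\<mu>)"
    by (subst dens) (rule nn_integral_density; measurable)
  also have "\<dots> \<le> (\<integral>\<^sup>+ x. ennreal (1 / K) * ennreal (exp (\<phi> x)) \<partial>\<mu>)"
  proof (rule nn_integral_mono)
    fix x
    have "g x * h x \<le> (1 / K) * exp (\<phi> x)"
      using K(2) by (cases "g x = 0") (auto simp: h_def)
    then show "ennreal (g x) * ennreal (h x) \<le> ennreal (1 / K) * ennreal (exp (\<phi> x))"
      using g0[of x] h0[of x] K(2) by (simp flip: ennreal_mult add: ennreal_leI)
  qed
  also have "\<dots> = ennreal (1 / K) * (\<integral>\<^sup>+ x. ennreal (exp (\<phi> x)) \<partial>\<mu>)"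
    by (rule nn_integral_cmult) measurable
  also have "\<dots> \<le> ennreal (1 / K) * ennreal K"
    using K by (intro mult_left_mono) auto
  also have "\<dots> = ennreal 1" using K(2) by (simp flip: ennreal_mult)
  finally have h1: "(\<integral>\<^sup>+ x. ennreal (h x) \<partial>\<nu>) \<le> ennreal 1" .
  have hint: "integrable \<nu> h"
    using h1 h0 by (intro integrableI_nonneg) (auto simp: less_top[symmetric] top_unique)
  have "ennreal (\<integral>x. h x \<partial>\<nu>) \<le> ennreal 1"
    using h1 nn_integral_eq_integral[OF hint] h0 by simp
  then have h2: "(\<integral>x. h x \<partial>\<nu>) \<le> 1" by (subst (asm) ennreal_le_iff) auto
  have pos: "AE x in \<nu>. 0 < g x"
    by (subst dens) (simp add: AE_density)
  have "(\<integral>x. \<phi> x - ln (g x) - ln K \<partial>\<nu>) \<le> (\<integral>x. h x - 1 \<partial>\<nu>)"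
  proof (rule integral_mono_AE)
    show "AE x in \<nu>. \<phi> x - ln (g x) - ln K \<le> h x - 1"
      using pos
    proof eventually_elim
      case (elim x)
      then have "ln (h x) = \<phi> x - ln (g x) - ln K"
        using K(2) by (simp add: h_def ln_div ln_mult)
      moreover have "0 < h x" using elim K(2) by (simp add: h_def)
      ultimately show ?case using ln_le_minus_one[of "h x"] by simp
    qed
  qed (use \<phi> int hint in auto)
  also have "\<dots> \<le> 0" using hint h2 N.prob_space by simp
  finally have "(\<integral>x. \<phi> x \<partial>\<nu>) - (\<integral>x. ln (g x) \<partial>\<nu>) - ln K \<le> 0"
    using \<phi> int N.prob_space by simp
  then show ?thesis by (simp add: H)
qed simp

lemma rel_entropy_uniform_measure:
  assumes \<mu>: "prob_space \<mu>" and A [measurable]: "A \<in> sets \<mu>" and pos: "0 < measure \<mu> A"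
  shows "rel_entropy (uniform_measure \<mu> A) \<mu> = ereal (- ln (measure \<mu> A))"
proof -
  interpret M: prob_space \<mu> by fact
  let ?\<nu> = "uniform_measure \<mu> A"
  have em: "emeasure \<mu> A = ennreal (measure \<mu> A)" by (rule M.emeasure_eq_measure)
  interpret N: prob_space ?\<nu>
    using pos by (intro prob_space_uniform_measure) (auto simp: em)
  have ac: "absolutely_continuous \<mu> ?\<nu>"
    unfolding uniform_measure_def by (rule absolutely_continuousI_density) measurable
  have "AE x in \<mu>. indicator A x / emeasure \<mu> A = RN_deriv \<mu> ?\<nu> x"
    by (rule M.RN_deriv_unique) (auto simp: uniform_measure_def)
  then have ae: "AE x in ?\<nu>. enn2real (RN_deriv \<mu> ?\<nu> x) = 1 / measure \<mu> A"
  proof (intro AE_uniform_measureI A, eventually_elim, intro impI)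
    fix x assume "indicator A x / emeasure \<mu> A = RN_deriv \<mu> ?\<nu> x" "x \<in> A"
    then have "RN_deriv \<mu> ?\<nu> x = ennreal (1 / measure \<mu> A)"
      using pos by (simp add: em divide_ennreal flip: ennreal_1)
    then show "enn2real (RN_deriv \<mu> ?\<nu> x) = 1 / measure \<mu> A" by simp
  qed
  have ln0: "ln (measure \<mu> A) \<le> 0" using pos M.prob_le_1[of A] by simp
  have "(\<integral>\<^sup>+ x. ennreal (ln (enn2real (RN_deriv \<mu> ?\<nu> x))) \<partial>?\<nu>)
      = (\<integral>\<^sup>+ x. ennreal (- ln (measure \<mu> A)) \<partial>?\<nu>)"
    using ae by (intro nn_integral_cong_AE) (auto simp: ln_div pos)
  moreover have "(\<integral>\<^sup>+ x. ennreal (- ln (enn2real (RN_deriv \<mu> ?\<nu> x))) \<partial>?\<nu>) = (\<integral>\<^sup>+ x. 0 \<partial>?\<nu>)"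
    using ae ln0 pos by (intro nn_integral_cong_AE) (auto simp: ln_div ennreal_neg)
  ultimately show ?thesis
    using ac N.emeasure_space_1 ln0
    by (simp add: rel_entropy_def enn2ereal_ennreal zero_ennreal.rep_eq)
qed

lemma rel_entropy_self:
  assumes \<mu>: "prob_space \<mu>" shows "rel_entropy \<mu> \<mu> = 0"
proof -
  interpret prob_space \<mu> by fact
  have "uniform_measure \<mu> (space \<mu>) = density \<mu> (\<lambda>_. 1)"
    unfolding uniform_measure_def by (intro density_cong) (auto simp: emeasure_space_1)
  then show ?thesis
    using rel_entropy_uniform_measure[OF \<mu>, of "space \<mu>"] by (simp add: density_1 prob_space zero_ereal_def)
qed

lemma rel_entropy_nonneg:
  assumes "prob_space \<mu>" "prob_space \<nu>" "sets \<nu> = sets \<mu>"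
  shows "0 \<le> rel_entropy \<nu> \<mu>"
proof -
  interpret prob_space \<mu> by fact
  show ?thesis
    using gibbs_variational_inequality[OF assms, of "\<lambda>_. 0" 1]
    by (simp add: emeasure_space_1 zero_ereal_def)
qed

section \<open>From exponential moments to transport inequalities\<close>

text \<open>
  The best coupling for the discrete distance leaves the common part \<open>min g 1\<close> in place and
  moves the deficit \<open>1 - g\<close> of \<open>\<mu>\<close> to the excess \<open>g - 1\<close>, rescaled to a probability measure \<open>\<rho>\<close>.
  Charging every moved point for the detour through \<open>z\<close> gives the total variation weighted by
  the distance to \<open>z\<close>.
\<close>

lemma transport_cost_le_weighted_variation:
  fixes d :: "'a::polish_space \<Rightarrow> 'a \<Rightarrow> real" and g :: "'a \<Rightarrow> real"
  assumes d: "lsc_metric d" and \<mu>: "\<mu> \<in> borel_probs" and \<nu>: "\<nu> \<in> borel_probs"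
    and g [measurable]: "g \<in> borel_measurable borel" and g0: "\<And>x. 0 \<le> g x"
    and dens: "\<nu> = density \<mu> (\<lambda>x. ennreal (g x))"
  shows "transport_cost d \<mu> \<nu> \<le> (\<integral>\<^sup>+ x. ennreal (\<bar>g x - 1\<bar> * d z x) \<partial>\<mu>)"
proof -
  have [measurable_cong]: "sets \<mu> = sets borel" "sets \<nu> = sets borel"
    using \<mu> \<nu> by (auto simp: borel_probs_def)
  interpret M: prob_space \<mu> using \<mu> by (simp add: borel_probs_def)
  interpret N: prob_space \<nu> using \<nu> by (simp add: borel_probs_def)
  note [measurable] = lsc_metric_measurable[OF d]
  have nn: "0 \<le> d z x" for x
    by (rule lsc_metric_nonneg[OF d])
  define p where "p x = min (g x) 1" for x
  have p [measurable]: "p \<in> borel_measurable borel" unfolding p_def by measurable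
  have p01: "0 \<le> p x" "p x \<le> 1" for x using g0[of x] by (auto simp: p_def)
  have split: "ennreal (p x) + ennreal (g x - 1) = ennreal (g x)" for x
  proof (cases "g x \<le> 1")
    case False
    then have "ennreal 1 + ennreal (g x - 1) = ennreal (g x)"
      by (subst ennreal_plus[symmetric]) auto
    then show ?thesis using False by (simp add: p_def)
  qed (simp add: p_def ennreal_neg)
  define m where "m = (\<integral>\<^sup>+ x. ennreal (g x - 1) \<partial>\<mu>)"
  have one: "(\<integral>\<^sup>+ x. ennreal (g x) \<partial>\<mu>) = 1"
    using N.emeasure_space_1 unfolding dens by (simp add: emeasure_density cong: nn_integral_cong)
  have 1: "(\<integral>\<^sup>+ x. ennreal (p x) \<partial>\<mu>) + m = 1"
    unfolding m_def by (subst nn_integral_add[symmetric]) (auto simp: split one)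
  have 2: "(\<integral>\<^sup>+ x. ennreal (p x) \<partial>\<mu>) + (\<integral>\<^sup>+ x. ennreal (1 - p x) \<partial>\<mu>) = 1"
    using p01 by (subst nn_integral_add[symmetric]) (auto simp: M.emeasure_space_1 simp flip: ennreal_plus)
  have defect: "(\<integral>\<^sup>+ x. ennreal (1 - p x) \<partial>\<mu>) = m"
    using 1 2 by (metis ennreal_add_left_cancel ennreal_add_eq_top ennreal_one_neq_top)
  have m_top: "m \<noteq> \<infinity>" using 1 by auto
  \<comment> \<open>If there is no excess, nothing is redrawn and any probability measure serves as \<open>\<rho>\<close>.\<close>
  define \<rho> where "\<rho> = (if m = 0 then \<nu> else density \<mu> (\<lambda>x. ennreal (g x - 1) / m))"
  have [measurable_cong]: "sets \<rho> = sets borel"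
    using \<open>sets \<mu> = sets borel\<close> \<open>sets \<nu> = sets borel\<close> by (simp add: \<rho>_def)
  have res: "m * (\<integral>\<^sup>+ x. h x \<partial>\<rho>) = (\<integral>\<^sup>+ x. ennreal (g x - 1) * h x \<partial>\<mu>)"
    if [measurable]: "h \<in> borel_measurable borel" for h
  proof (cases "m = 0")
    case True
    then have "AE x in \<mu>. ennreal (g x - 1) = 0"
      unfolding m_def by (subst (asm) nn_integral_0_iff_AE) auto
    then have "AE x in \<mu>. ennreal (g x - 1) * h x = 0" by eventually_elim simp
    then show ?thesis using True by (subst (2) nn_integral_cong_AE) auto
  next
    case False
    have "(\<integral>\<^sup>+ x. h x \<partial>\<rho>) = (\<integral>\<^sup>+ x. ennreal (g x - 1) / m * h x \<partial>\<mu>)"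
      using False unfolding \<rho>_def by (simp add: nn_integral_density)
    also have "m * \<dots> = (\<integral>\<^sup>+ x. m * (ennreal (g x - 1) / m * h x) \<partial>\<mu>)"
      by (rule nn_integral_cmult[symmetric]) measurable
    also have "\<dots> = (\<integral>\<^sup>+ x. ennreal (g x - 1) * h x \<partial>\<mu>)"
      using False m_top
      by (intro nn_integral_cong)
        (simp add: mult.assoc[symmetric] ennreal_times_divide mult.commute[of m] ennreal_mult_divide_eq)
    finally show ?thesis .
  qed
  have "emeasure \<rho> (space \<rho>) = 1"
  proof (cases "m = 0")
    case False
    have "m * emeasure \<rho> (space \<rho>) = m * 1"
      using res[of "\<lambda>_. 1"] by (simp add: m_def)
    then show ?thesis using False m_top by (subst (asm) ennreal_mult_cancel_left) auto
  qed (simp add: \<rho>_def N.emeasure_space_1)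
  then have \<rho>: "\<rho> \<in> borel_probs"
    using \<open>sets \<rho> = sets borel\<close> by (auto simp: borel_probs_def intro: prob_spaceI)
  have mix: "emeasure \<nu> A =
      (\<integral>\<^sup>+ x. ennreal (p x) * indicator A x \<partial>\<mu>) + (\<integral>\<^sup>+ x. ennreal (1 - p x) \<partial>\<mu>) * emeasure \<rho> A"
    if [measurable]: "A \<in> sets borel" for A
  proof -
    have "emeasure \<nu> A = (\<integral>\<^sup>+ x. ennreal (g x) * indicator A x \<partial>\<mu>)"
      unfolding dens by (rule emeasure_density) measurable
    also have "\<dots> = (\<integral>\<^sup>+ x. ennreal (p x) * indicator A x \<partial>\<mu>) + (\<integral>\<^sup>+ x. ennreal (g x - 1) * indicator A x \<partial>\<mu>)"
      by (subst nn_integral_add[symmetric]) (auto simp flip: split distrib_right)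
    also have "(\<integral>\<^sup>+ x. ennreal (g x - 1) * indicator A x \<partial>\<mu>) = m * emeasure \<rho> A"
      by (subst res[symmetric]) auto
    finally show ?thesis by (simp add: defect)
  qed
  have "transport_cost d \<mu> \<nu> \<le> (\<integral>\<^sup>+ x. ennreal (1 - p x) * ennreal (d z x) \<partial>\<mu>)
      + m * (\<integral>\<^sup>+ y. ennreal (d z y) \<partial>\<rho>)"
    using transport_cost_le_mixture_moments[OF d \<mu> \<rho> \<nu> p p01 mix, of z] by (simp add: defect)
  also have "\<dots> = (\<integral>\<^sup>+ x. (ennreal (1 - p x) + ennreal (g x - 1)) * ennreal (d z x) \<partial>\<mu>)"
    by (subst res) (auto simp: distrib_right nn_integral_add)
  also have "\<dots> = (\<integral>\<^sup>+ x. ennreal (\<bar>g x - 1\<bar> * d z x) \<partial>\<mu>)"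
    using nn by (intro nn_integral_cong) (auto simp: p_def min_def ennreal_neg ennreal_mult)
  finally show ?thesis .
qed

text \<open>
  Bernstein's estimate: for \<open>k \<ge> 2\<close> and \<open>\<bar>r\<bar> \<le> 1\<close> the \<open>k\<close>-th term of the exponential series of
  \<open>r * y\<close> is at most \<open>r\<^sup>2\<close> times that of \<open>\<bar>y\<bar>\<close>.
\<close>

lemma exp_scaled_le:
  fixes r y :: real
  assumes r: "\<bar>r\<bar> \<le> 1"
  shows "exp (r * y) \<le> 1 + r * y + r\<^sup>2 * (exp \<bar>y\<bar> - 1)"
proof -
  let ?c = "\<lambda>x n. inverse (fact (n + 2)) *\<^sub>R (x ^ (n + 2)) :: real"
  have sm: "summable (?c x)" for x :: real
    using summable_ignore_initial_segment[OF summable_exp_generic[of x], of 2] by simp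
  have "(\<Sum>n. ?c (r * y) n) \<le> (\<Sum>n. r\<^sup>2 * ?c \<bar>y\<bar> n)"
  proof (rule suminf_le)
    fix n
    have "(r * y) ^ (n + 2) \<le> \<bar>r * y\<bar> ^ (n + 2)"
      by (metis abs_ge_self power_abs)
    also have "\<dots> = \<bar>r\<bar> ^ n * (r\<^sup>2 * \<bar>y\<bar> ^ (n + 2))"
      by (simp add: abs_mult power_mult_distrib power_add power2_eq_square)
    also have "\<dots> \<le> 1 * (r\<^sup>2 * \<bar>y\<bar> ^ (n + 2))"
      using r by (intro mult_right_mono power_le_one) auto
    finally have "(r * y) ^ (n + 2) \<le> r\<^sup>2 * \<bar>y\<bar> ^ (n + 2)" by simp
    then have "inverse (fact (n + 2)) * (r * y) ^ (n + 2)
        \<le> inverse (fact (n + 2)) * (r\<^sup>2 * \<bar>y\<bar> ^ (n + 2))"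
      by (rule mult_left_mono) (simp del: fact_Suc add_2_eq_Suc')
    then show "?c (r * y) n \<le> r\<^sup>2 * ?c \<bar>y\<bar> n"
      by (simp only: real_scaleR_def mult_ac)
  qed (use sm summable_mult[OF sm] in auto)
  also have "\<dots> = r\<^sup>2 * (\<Sum>n. ?c \<bar>y\<bar> n)" by (rule suminf_mult[OF sm])
  finally have "exp (r * y) - 1 - r * y \<le> r\<^sup>2 * (exp \<bar>y\<bar> - 1 - \<bar>y\<bar>)"
    using exp_first_two_terms[of "r * y"] exp_first_two_terms[of "\<bar>y\<bar>"] by simp
  also have "\<dots> \<le> r\<^sup>2 * (exp \<bar>y\<bar> - 1)" by (intro mult_left_mono) auto
  finally show ?thesis by simp
qed

text \<open>
  The weighted variation is the difference of the \<open>\<nu>\<close>- and the \<open>\<mu>\<close>-integral of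
  \<open>\<phi>\<close>, which is \<open>\<psi>\<close> where \<open>g \<ge> 1\<close> and \<open>- \<psi>\<close> elsewhere.  Gibbs' inequality for \<open>r * a * \<phi>\<close> bounds it by the entropy plus a
  logarithmic Laplace transform, and Bernstein's estimate bounds the latter by
  \<open>r * a * \<integral>\<phi> d\<mu> + r\<^sup>2\<close>; the bound 2 on the exponential moment is what makes the coefficient
  of \<open>r\<^sup>2\<close> equal to 1.
\<close>

lemma weighted_variation_entropy_bound:
  fixes g \<psi> :: "'a \<Rightarrow> real"
  assumes \<mu>: "prob_space \<mu>" and \<nu>: "prob_space \<nu>"
    and g [measurable]: "g \<in> borel_measurable \<mu>" and g0: "\<And>x. 0 \<le> g x"
    and dens: "\<nu> = density \<mu> (\<lambda>x. ennreal (g x))"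
    and \<psi>: "\<And>x. 0 \<le> \<psi> x" "integrable \<mu> \<psi>" "integrable \<nu> \<psi>"
    and a: "0 \<le> a" "(\<integral>\<^sup>+ x. ennreal (exp (a * \<psi> x)) \<partial>\<mu>) \<le> 2"
    and H: "rel_entropy \<nu> \<mu> = ereal H" and r: "0 \<le> r" "r \<le> 1"
  shows "integrable \<mu> (\<lambda>x. \<bar>g x - 1\<bar> * \<psi> x)"
    and "r * (a * (\<integral>x. \<bar>g x - 1\<bar> * \<psi> x \<partial>\<mu>)) \<le> H + r\<^sup>2"
proof -
  interpret M: prob_space \<mu> by fact
  have sets [measurable_cong]: "sets \<nu> = sets \<mu>" by (simp add: dens)
  have [measurable]: "\<psi> \<in> borel_measurable \<mu>" using \<psi>(2) by simp
  define \<sigma> :: "'a \<Rightarrow> real" where "\<sigma> x = (if 1 \<le> g x then 1 else -1)" for x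
  have [measurable]: "\<sigma> \<in> borel_measurable \<mu>" unfolding \<sigma>_def by measurable
  have \<sigma>: "\<bar>\<sigma> x\<bar> = 1" for x by (simp add: \<sigma>_def)
  define \<phi> where "\<phi> x = \<sigma> x * \<psi> x" for x
  have [measurable]: "\<phi> \<in> borel_measurable \<mu>" unfolding \<phi>_def by measurable
  have abs: "\<bar>\<phi> x\<bar> = \<psi> x" for x using \<psi>(1)[of x] \<sigma>[of x] by (simp add: \<phi>_def abs_mult)
  have \<phi>\<mu>: "integrable \<mu> \<phi>"
    by (rule Bochner_Integration.integrable_bound[OF \<psi>(2)]) (auto simp: abs)
  have \<phi>\<nu>: "integrable \<nu> \<phi>"
    by (rule Bochner_Integration.integrable_bound[OF \<psi>(3)]) (auto simp: abs)
  have g\<phi>: "integrable \<mu> (\<lambda>x. g x * \<phi> x)"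
    using \<phi>\<nu> unfolding dens by (subst (asm) integrable_density) (auto simp: g0)
  have var: "\<bar>g x - 1\<bar> * \<psi> x = g x * \<phi> x - \<phi> x" for x
    by (auto simp: \<phi>_def \<sigma>_def algebra_simps)
  show "integrable \<mu> (\<lambda>x. \<bar>g x - 1\<bar> * \<psi> x)"
    unfolding var using g\<phi> \<phi>\<mu> by simp
  have "(\<integral>x. \<phi> x \<partial>\<nu>) = (\<integral>x. g x * \<phi> x \<partial>\<mu>)"
    unfolding dens by (subst integral_density) (auto simp: g0)
  then have D: "(\<integral>x. \<bar>g x - 1\<bar> * \<psi> x \<partial>\<mu>) = (\<integral>x. \<phi> x \<partial>\<nu>) - (\<integral>x. \<phi> x \<partial>\<mu>)"
    unfolding var using g\<phi> \<phi>\<mu> by simp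
  have ei: "integrable \<mu> (\<lambda>x. exp (a * \<psi> x))"
    using a(2) by (intro integrableI_nonneg) (auto simp: less_top[symmetric] top_unique)
  have "ennreal (\<integral>x. exp (a * \<psi> x) \<partial>\<mu>) \<le> ennreal 2"
    using a(2) nn_integral_eq_integral[OF ei] by simp
  then have e2: "(\<integral>x. exp (a * \<psi> x) \<partial>\<mu>) \<le> 2" by (subst (asm) ennreal_le_iff) auto
  define J where "J = (\<integral>x. \<phi> x \<partial>\<mu>)"
  define K where "K = 1 + r * (a * J) + r\<^sup>2"
  \<comment> \<open>The logarithm of \<open>K\<close> makes sense since \<open>a * J\<close> lies between -1 and 1: \<open>1 - r + r\<^sup>2 > 0\<close>.\<close>
  have "a * \<bar>J\<bar> \<le> a * (\<integral>x. \<psi> x \<partial>\<mu>)"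
    unfolding J_def using a(1) integral_abs_bound[of \<mu> \<phi>] by (intro mult_left_mono) (auto simp: abs)
  also have "\<dots> = (\<integral>x. a * \<psi> x \<partial>\<mu>)" by simp
  also have "\<dots> \<le> (\<integral>x. exp (a * \<psi> x) - 1 \<partial>\<mu>)"
  proof (rule integral_mono)
    fix x show "a * \<psi> x \<le> exp (a * \<psi> x) - 1"
      using exp_ge_add_one_self[of "a * \<psi> x"] by linarith
  qed (use \<psi> ei in auto)
  also have "\<dots> \<le> 1" using ei e2 M.prob_space by simp
  finally have aJ: "\<bar>a * J\<bar> \<le> 1" using a(1) by (simp add: abs_mult)
  have K: "0 < K"
  proof (cases "r = 1")
    case False
    have "\<bar>r * (a * J)\<bar> \<le> r * 1" using r aJ by (simp add: abs_mult mult_left_le)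
    then have "- r \<le> r * (a * J)" by linarith
    moreover have "r < 1" using False r by simp
    ultimately show ?thesis unfolding K_def by (smt (verit) zero_le_power2)
  qed (use aJ in \<open>simp add: K_def\<close>)
  let ?u = "\<lambda>x. 1 + r * (a * \<phi> x) + r\<^sup>2 * (exp (a * \<psi> x) - 1)"
  have ptw: "exp (r * (a * \<phi> x)) \<le> ?u x" for x
    using exp_scaled_le[of r "a * \<phi> x"] r a(1) by (simp add: abs_mult abs)
  have u: "integrable \<mu> ?u" using \<phi>\<mu> ei by simp
  have u0: "0 \<le> ?u x" for x using ptw[of x] by (smt (verit) exp_ge_zero)
  have "(\<integral>\<^sup>+ x. ennreal (exp (r * (a * \<phi> x))) \<partial>\<mu>) \<le> (\<integral>\<^sup>+ x. ennreal (?u x) \<partial>\<mu>)"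
    by (intro nn_integral_mono ennreal_leI ptw)
  also have "\<dots> = ennreal (\<integral>x. ?u x \<partial>\<mu>)"
    using u u0 by (intro nn_integral_eq_integral) auto
  also have "(\<integral>x. ?u x \<partial>\<mu>) = 1 + r * (a * J) + r\<^sup>2 * ((\<integral>x. exp (a * \<psi> x) \<partial>\<mu>) - 1)"
    using \<phi>\<mu> ei M.prob_space by (simp add: J_def)
  also have "ennreal \<dots> \<le> ennreal K"
    unfolding K_def using e2 by (intro ennreal_leI add_left_mono mult_left_le) auto
  finally have "(\<integral>\<^sup>+ x. ennreal (exp (r * (a * \<phi> x))) \<partial>\<mu>) \<le> ennreal K" .
  from gibbs_variational_inequality[OF \<mu> \<nu> sets _ this K]
  have "r * (a * (\<integral>x. \<phi> x \<partial>\<nu>)) \<le> H + ln K"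
    using \<phi>\<nu> by (simp add: H)
  also have "ln K \<le> K - 1" using K by (rule ln_le_minus_one)
  finally show "r * (a * (\<integral>x. \<bar>g x - 1\<bar> * \<psi> x \<partial>\<mu>)) \<le> H + r\<^sup>2"
    unfolding D K_def J_def by (simp add: algebra_simps)
qed

text \<open>
  The optimal \<open>r\<close> is \<open>sqrt H\<close>, truncated at 1; for \<open>H > 1\<close> the choice \<open>r = 1\<close> gives
  \<open>H + 1 \<le> H + 2 * sqrt H\<close>.  For \<open>H = 0\<close> let \<open>r\<close> tend to 0.
\<close>

lemma optimize_square_bound:
  fixes H x :: real
  assumes H: "0 \<le> H" and bound: "\<And>r. 0 \<le> r \<Longrightarrow> r \<le> 1 \<Longrightarrow> r * x \<le> H + r\<^sup>2"
  shows "x \<le> H + 2 * sqrt H"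
proof -
  consider "H = 0" | "0 < H" "H \<le> 1" | "1 < H" using H by linarith
  then show ?thesis
  proof cases
    case 1
    have "x \<le> 0"
    proof (rule ccontr)
      assume "\<not> x \<le> 0"
      then have r: "0 < min 1 (x / 2)" by simp
      have "min 1 (x / 2) * x \<le> min 1 (x / 2) * min 1 (x / 2)"
        using bound[of "min 1 (x / 2)"] 1 r by (simp add: power2_eq_square)
      then have "x \<le> min 1 (x / 2)" using r by (rule mult_left_le_imp_le)
      then show False using \<open>\<not> x \<le> 0\<close> by simp
    qed
    then show ?thesis using 1 by simp
  next
    case 2
    have "sqrt H * x \<le> H + (sqrt H)\<^sup>2" using 2 by (intro bound) auto
    also have "\<dots> = sqrt H * (2 * sqrt H)" using 2 by (simp add: power2_eq_square)
    finally have "x \<le> 2 * sqrt H" by (rule mult_left_le_imp_le) (use 2 in simp)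
    then show ?thesis using 2 by simp
  next
    case 3
    then have "1 \<le> sqrt H" by simp
    moreover have "x \<le> H + 1" using bound[of 1] by simp
    ultimately show ?thesis by linarith
  qed
qed

text \<open>
  The bound \<open>a * T \<le> H + 2 * sqrt H\<close> says \<open>a * T + 1 \<le> (1 + sqrt H)\<^sup>2\<close>.
\<close>

lemma transport_inequality_quadratic_linear:
  fixes d :: "'a::polish_space \<Rightarrow> 'a \<Rightarrow> real"
  assumes d: "lsc_metric d" and \<mu>: "\<mu> \<in> borel_probs_d d" and \<nu>: "\<nu> \<in> borel_probs_d d"
    and a: "0 \<le> a" "(\<integral>\<^sup>+ x. ennreal (exp (a * d z x)) \<partial>\<mu>) \<le> 2"
  shows "ereal ((sqrt (a * enn2real (transport_cost d \<mu> \<nu>) + 1) - 1)\<^sup>2) \<le> rel_entropy \<nu> \<mu>"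
proof (cases "rel_entropy \<nu> \<mu> = \<infinity>")
  case False
  let ?T = "enn2real (transport_cost d \<mu> \<nu>)"
  have \<mu>': "prob_space \<mu>" "\<mu> \<in> borel_probs" and \<nu>': "prob_space \<nu>" "\<nu> \<in> borel_probs"
    and sets: "sets \<mu> = sets borel" "sets \<nu> = sets \<mu>"
    using \<mu> \<nu> by (auto simp: borel_probs_d_def borel_probs_def)
  have nn: "0 \<le> d z x" for x
    by (rule lsc_metric_nonneg[OF d])
  from rel_entropy_finite_density[OF \<mu>'(1) \<nu>'(1) sets(2) False] obtain g where
    g: "g \<in> borel_measurable \<mu>" and g0: "\<And>x. 0 \<le> g x"
    and dens: "\<nu> = density \<mu> (\<lambda>x. ennreal (g x))"
    and "rel_entropy \<nu> \<mu> = ereal (\<integral>x. ln (g x) \<partial>\<nu>)" by blast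
  then obtain H where H: "rel_entropy \<nu> \<mu> = ereal H" by blast
  have H0: "0 \<le> H" using rel_entropy_nonneg[OF \<mu>'(1) \<nu>'(1) sets(2)] H by simp
  have g': "g \<in> borel_measurable borel" using g sets by (simp cong: measurable_cong_sets)
  let ?D = "\<integral>x. \<bar>g x - 1\<bar> * d z x \<partial>\<mu>"
  note bound = weighted_variation_entropy_bound[OF \<mu>'(1) \<nu>'(1) g g0 dens nn
      finite_moment[OF d \<mu>] finite_moment[OF d \<nu>] a H]
  have D0: "0 \<le> ?D" by (rule integral_nonneg_AE) (simp add: nn)
  have "transport_cost d \<mu> \<nu> \<le> ennreal ?D"
    using transport_cost_le_weighted_variation[OF d \<mu>'(2) \<nu>'(2) g' g0 dens, of z]
      nn_integral_eq_integral[OF bound(1)[of 0]] nn by simp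
  then have T: "?T \<le> ?D" by (rule enn2real_leI[OF D0])
  have "a * ?D \<le> H + 2 * sqrt H"
    by (rule optimize_square_bound[OF H0]) (rule bound(2))
  then have "a * ?T + 1 \<le> (1 + sqrt H)\<^sup>2"
    using mult_left_mono[OF T a(1)] H0 by (simp add: power2_sum)
  then have "sqrt (a * ?T + 1) \<le> 1 + sqrt H"
    using H0 by (intro real_le_lsqrt) auto
  moreover have "1 \<le> sqrt (a * ?T + 1)" using a(1) by simp
  ultimately have "(sqrt (a * ?T + 1) - 1)\<^sup>2 \<le> (sqrt H)\<^sup>2"
    by (intro power_mono) auto
  then show ?thesis using H H0 by simp
qed simp

text \<open>
  A function in \<^const>\<open>class_C\<close> is the supremum of its nondecreasing affine minorants.  If the
  function is infinite at some \<open>k < m\<close>, steep lines through \<open>(k, 0)\<close> do.  Otherwise left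
  continuity gives \<open>m1 < m0 < m\<close> at which the function exceeds \<open>c\<close>; the chord over \<open>[m1, m0]\<close> lies
  below the graph outside that interval, and when lowered so that it passes through
  \<open>(m0, \<gamma> m1)\<close> it also lies below the graph inside, while at \<open>m\<close> it is still above \<open>c\<close>.
\<close>

lemma class_C_affine_minorant:
  assumes \<gamma>: "\<gamma> \<in> class_C" and m: "0 < m" and c: "ereal c < \<gamma> m"
  obtains p q where "0 \<le> p" "\<And>t. 0 \<le> t \<Longrightarrow> ereal (p * t + q) \<le> \<gamma> t" "c \<le> p * m + q"
proof -
  have nn: "\<And>t. 0 \<le> t \<Longrightarrow> 0 \<le> \<gamma> t" and z: "\<gamma> 0 = 0" and mono: "mono_on {0..} \<gamma>"
    and cvx: "\<And>s t l. 0 \<le> s \<Longrightarrow> 0 \<le> t \<Longrightarrow> l \<in> {0..1} \<Longrightarrow>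
        \<gamma> ((1 - l) * s + l * t) \<le> ereal (1 - l) * \<gamma> s + ereal l * \<gamma> t"
    and lc: "(\<gamma> \<longlongrightarrow> \<gamma> m) (at_left m)"
    using \<gamma> m by (auto simp: class_C_def)
  show thesis
  proof (cases "\<exists>k. 0 \<le> k \<and> k < m \<and> \<gamma> k = \<infinity>")
    case True
    then obtain k where k: "0 \<le> k" "k < m" "\<gamma> k = \<infinity>" by blast
    define p where "p = \<bar>c\<bar> / (m - k)"
    have p: "0 \<le> p" using k by (simp add: p_def)
    show thesis
    proof (rule that[OF p])
      fix t :: real assume t: "0 \<le> t"
      show "ereal (p * t + - p * k) \<le> \<gamma> t"
      proof (cases "t \<le> k")
        case True
        then have "p * t + - p * k \<le> 0" using p by (simp add: mult_left_mono)
        then show ?thesis by (intro order_trans[OF _ nn[OF t]]) (simp only: ereal_less_eq)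
      next
        case False
        then have "\<gamma> k \<le> \<gamma> t" using k t by (intro mono_onD[OF mono]) auto
        then show ?thesis using k by simp
      qed
    next
      have "p * m + - p * k = p * (m - k)" by (simp add: algebra_simps)
      also have "\<dots> = \<bar>c\<bar>" using k by (simp add: p_def)
      finally show "c \<le> p * m + - p * k" by simp
    qed
  next
    case False
    have "eventually (\<lambda>t. ereal c < \<gamma> t) (at_left m)"
      using order_tendstoD(1)[OF lc c] .
    then obtain b where b: "b < m" "\<And>t. b < t \<Longrightarrow> t < m \<Longrightarrow> ereal c < \<gamma> t"
      using m by (auto simp: eventually_at_left_field)
    \<comment> \<open>A negative \<open>b\<close> is replaced by 0 in order to place \<open>m1\<close> and \<open>m0\<close> between 0 and \<open>m\<close>.\<close>
    define b' where "b' = max b 0"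
    define m1 where "m1 = (2 * b' + m) / 3"
    define m0 where "m0 = (b' + 2 * m) / 3"
    have ord: "0 < m1" "b < m1" "m1 < m0" "m0 < m"
      using b(1) m by (auto simp: m1_def m0_def b'_def max_def)
    obtain G0 where G0: "\<gamma> m0 = ereal G0"
      using nn[of m0] False ord by (cases "\<gamma> m0") auto
    obtain G1 where G1: "\<gamma> m1 = ereal G1"
      using nn[of m1] False ord by (cases "\<gamma> m1") auto
    have cG: "c < G1" using b(2)[of m1] ord G1 by simp
    have GG: "G1 \<le> G0" using mono_onD[OF mono, of m1 m0] ord G0 G1 by simp
    define s where "s = (G0 - G1) / (m0 - m1)"
    have s: "0 \<le> s" using GG ord by (simp add: s_def)
    have s': "s * (m0 - m1) = G0 - G1" using ord by (simp add: s_def)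
    show thesis
    proof (rule that[OF s])
      fix t :: real assume t: "0 \<le> t"
      have "G1 + s * (t - m0) \<le> y" if y: "\<gamma> t = ereal y" for y
      proof -
        consider "t < m1" | "m1 \<le> t" "t \<le> m0" | "m0 < t" by linarith
        then show ?thesis
        proof cases
          case 1
          define l where "l = (m1 - t) / (m0 - t)"
          have pos: "0 < m0 - t" using 1 ord by simp
          have l: "l \<in> {0..1}" using 1 ord pos by (simp add: l_def)
          have lm: "l * (m0 - t) = m1 - t" using pos by (simp add: l_def)
          have "(1 - l) * t + l * m0 = m1" using lm by (simp add: algebra_simps)
          then have "G1 \<le> (1 - l) * y + l * G0"
            using cvx[OF t _ l, of m0] ord by (simp add: y G0 G1)
          then have "(m0 - t) * G1 \<le> (m0 - t) * ((1 - l) * y + l * G0)"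
            using pos by (intro mult_left_mono) auto
          also have "\<dots> = (m0 - t) * y - (l * (m0 - t)) * y + (l * (m0 - t)) * G0"
            by (simp add: algebra_simps)
          also have "\<dots> = (m0 - m1) * y + (m1 - t) * G0"
            unfolding lm by (simp add: algebra_simps)
          finally have "(m0 - m1) * (G1 - y) \<le> (m1 - t) * (G0 - G1)"
            by (simp add: algebra_simps)
          also have "\<dots> = (m0 - m1) * (s * (m1 - t))"
            unfolding s'[symmetric] by simp
          finally have "G1 - y \<le> s * (m1 - t)"
            by (rule mult_left_le_imp_le) (use ord in simp)
          also have "\<dots> \<le> s * (m0 - t)" using s ord by (intro mult_left_mono) auto
          finally show ?thesis by (simp add: algebra_simps)
        next
          case 2
          then have "G1 \<le> y" using mono_onD[OF mono, of m1 t] ord t y G1 by simp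
          moreover have "s * (t - m0) \<le> 0" using 2 s by (simp add: mult_nonneg_nonpos)
          ultimately show ?thesis by simp
        next
          case 3
          define l where "l = (m0 - m1) / (t - m1)"
          have pos: "0 < t - m1" using 3 ord by simp
          have l: "l \<in> {0..1}" using 3 ord pos by (simp add: l_def)
          have lm: "l * (t - m1) = m0 - m1" using pos by (simp add: l_def)
          have "(1 - l) * m1 + l * t = m0" using lm by (simp add: algebra_simps)
          then have "G0 \<le> (1 - l) * G1 + l * y"
            using cvx[OF _ t l, of m1] ord by (simp add: y G0 G1)
          then have "G0 - G1 \<le> l * (y - G1)" by (simp add: algebra_simps)
          then have "(t - m1) * (G0 - G1) \<le> (t - m1) * (l * (y - G1))"
            using pos by (intro mult_left_mono) auto
          also have "\<dots> = (m0 - m1) * (y - G1)" unfolding lm[symmetric] by simp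
          also have "G0 - G1 = s * (m0 - m1)" using s' by simp
          finally have "(m0 - m1) * (s * (t - m1)) \<le> (m0 - m1) * (y - G1)" by (simp add: mult_ac)
          then have "s * (t - m1) \<le> y - G1"
            by (rule mult_left_le_imp_le) (use ord in simp)
          moreover have "s * (t - m0) \<le> s * (t - m1)" using s ord by (intro mult_left_mono) auto
          ultimately show ?thesis by simp
        qed
      qed
      then show "ereal (s * t + (G1 - s * m0)) \<le> \<gamma> t"
        using nn[OF t] by (cases "\<gamma> t") (auto simp: algebra_simps)
    next
      have "0 \<le> s * (m - m0)" using s ord by simp
      then show "c \<le> s * m + (G1 - s * m0)" using cG by (simp add: algebra_simps)
    qed
  qed
qed

text \<open>
  Replacing \<open>\<gamma>\<close> by an affine minorant \<open>p * t + q\<close> avoids Jensen's inequality for extended-valued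
  functions.  By the product coupling, \<open>2 * (p * T / 2 + q)\<close> is at most the sum of the integrals of
  \<open>p * d z + q\<close> under \<open>\<mu>\<close> and \<open>\<nu>\<close>, and Gibbs' inequality, used for each of these measures, bounds the two by
  \<open>ln B\<close> and by the entropy plus \<open>ln B\<close>.
\<close>

lemma transport_inequality_convex:
  fixes d :: "'a::polish_space \<Rightarrow> 'a \<Rightarrow> real"
  assumes d: "lsc_metric d" and \<mu>: "\<mu> \<in> borel_probs_d d" and \<nu>: "\<nu> \<in> borel_probs_d d"
    and \<gamma>: "\<gamma> \<in> class_C"
    and B: "(\<integral>\<^sup>+ x. exp_ext (\<gamma> (d z x)) \<partial>\<mu>) \<le> ennreal B"
  shows "2 * \<gamma> (enn2real (transport_cost d \<mu> \<nu>) / 2) - ereal (2 * ln B) \<le> rel_entropy \<nu> \<mu>"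
proof -
  let ?T = "enn2real (transport_cost d \<mu> \<nu>)"
  have \<mu>': "prob_space \<mu>" and \<nu>': "prob_space \<nu>" and sets: "sets \<nu> = sets \<mu>"
    using \<mu> \<nu> by (auto simp: borel_probs_d_def borel_probs_def)
  interpret M: prob_space \<mu> by fact
  interpret N: prob_space \<nu> by fact
  have nn: "0 \<le> d z x" for x
    by (rule lsc_metric_nonneg[OF d])
  have \<gamma>0: "\<gamma> 0 = 0" and \<gamma>nn: "\<And>t. 0 \<le> t \<Longrightarrow> 0 \<le> \<gamma> t"
    using \<gamma> by (auto simp: class_C_def)
  have exp_minorant: "ennreal (exp y) \<le> exp_ext e" if "ereal y \<le> e" for y e
    using that by (cases e) (auto simp: exp_ext_def intro: ennreal_leI)
  have "1 = (\<integral>\<^sup>+ x. 1 \<partial>\<mu>)" by (simp add: M.emeasure_space_1)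
  also have "\<dots> \<le> (\<integral>\<^sup>+ x. exp_ext (\<gamma> (d z x)) \<partial>\<mu>)"
    using exp_minorant[of 0] \<gamma>nn nn by (intro nn_integral_mono) (auto simp: zero_ereal_def)
  also note B
  finally have B1: "1 \<le> B" by simp
  have H0: "0 \<le> rel_entropy \<nu> \<mu>" by (rule rel_entropy_nonneg[OF \<mu>' \<nu>' sets])
  show ?thesis
  proof (cases "rel_entropy \<nu> \<mu> = \<infinity> \<or> ?T = 0")
    case True
    then show ?thesis
    proof
      assume "?T = 0"
      moreover have "ereal (- (2 * ln B)) \<le> rel_entropy \<nu> \<mu>"
        by (rule order_trans[OF _ H0]) (use B1 in simp)
      ultimately show ?thesis by (simp add: \<gamma>0)
    qed simp
  next
    case False
    then obtain H where H: "rel_entropy \<nu> \<mu> = ereal H"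
      using H0 by (cases "rel_entropy \<nu> \<mu>") auto
    have T: "0 < ?T / 2" using False by (simp add: order_less_le)
    have "\<gamma> (?T / 2) \<le> ereal (H / 2 + ln B)"
    proof (rule ccontr)
      assume "\<not> ?thesis"
      then obtain c where c: "ereal (H / 2 + ln B) < ereal c" "ereal c < \<gamma> (?T / 2)"
        using ereal_dense2 by (metis not_le)
      from class_C_affine_minorant[OF \<gamma> T c(2)] obtain p q where p: "0 \<le> p"
        and min: "\<And>t. 0 \<le> t \<Longrightarrow> ereal (p * t + q) \<le> \<gamma> t" and pq: "c \<le> p * (?T / 2) + q" by blast
      have E: "(\<integral>\<^sup>+ x. ennreal (exp (p * d z x + q)) \<partial>\<mu>) \<le> ennreal B"
        by (rule order_trans[OF nn_integral_mono B]) (intro exp_minorant min nn)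
      note I = finite_moment[OF d \<mu>, of z] finite_moment[OF d \<nu>, of z]
      have 1: "p * (\<integral>x. d z x \<partial>\<mu>) + q \<le> ln B"
        using gibbs_variational_inequality[OF \<mu>' \<mu>' refl _ E] I B1
        by (simp add: rel_entropy_self[OF \<mu>'] M.prob_space)
      have 2: "p * (\<integral>x. d z x \<partial>\<nu>) + q \<le> H + ln B"
        using gibbs_variational_inequality[OF \<mu>' \<nu>' sets _ E] I B1
        by (simp add: H N.prob_space)
      have "p * ?T \<le> p * ((\<integral>x. d z x \<partial>\<mu>) + (\<integral>x. d z x \<partial>\<nu>))"
        using transport_cost_le_integrals[OF d \<mu> \<nu>] p by (rule mult_left_mono)
      with 1 2 have "p * ?T + 2 * q \<le> H + 2 * ln B" by (simp add: distrib_left)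
      moreover have "H / 2 + ln B < p * (?T / 2) + q" using c(1) pq by simp
      ultimately show False by simp
    qed
    then show ?thesis
      using \<gamma>nn[of "?T / 2"] T H by (cases "\<gamma> (?T / 2)") auto
  qed
qed

section \<open>From transport inequalities to exponential moments\<close>

text \<open>
  Apply the transport inequality to \<open>\<mu>\<close> conditioned on \<open>A\<close>, whose relative entropy is
  \<open>- ln (\<mu> A)\<close>.  Its mean distance \<open>w\<close> to \<open>z\<close> is at most the \<open>\<mu>\<close>-mean \<open>m\<close> plus the transport cost,
  so it remains to see that \<open>\<alpha> (max 0 (w - m)) > r\<close>.  Were this false, monotonicity would put
  every point of \<open>A\<close> at a distance greater than \<open>w\<close> from \<open>z\<close>, contradicting that \<open>w\<close> is a mean.
\<close>

lemma transport_inequality_imp_deviation: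
  fixes d :: "'a::polish_space \<Rightarrow> 'a \<Rightarrow> real" and z :: 'a and r :: real
  assumes d: "lsc_metric d" and \<mu>: "\<mu> \<in> borel_probs_d d"
    and \<alpha>: "mono_on {0..} \<alpha>" and ineq: "transport_entropy_ineq d \<mu> \<alpha>"
  defines "A \<equiv> {x. ereal r < \<alpha> (max 0 (d z x - (\<integral>x. d z x \<partial>\<mu>)))}"
  shows "A \<in> sets borel" and "measure \<mu> A \<le> exp (- r)"
proof -
  define m where "m = (\<integral>x. d z x \<partial>\<mu>)"
  have \<mu>': "prob_space \<mu>" and sets [measurable_cong]: "sets \<mu> = sets borel"
    using \<mu> by (auto simp: borel_probs_d_def borel_probs_def)
  interpret M: prob_space \<mu> by fact
  note [measurable] = lsc_metric_measurable[OF d]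
  have nn: "0 \<le> d z x" for x
    by (rule lsc_metric_nonneg[OF d])
  let ?\<alpha> = "\<lambda>t. \<alpha> (max 0 (t - m))"
  have \<alpha>_mono: "?\<alpha> s \<le> ?\<alpha> t" if "s \<le> t" for s t
    using that by (intro mono_onD[OF \<alpha>]) auto
  have "is_interval {t. ereal r < ?\<alpha> t}"
    unfolding is_interval_1 using \<alpha>_mono less_le_trans by blast
  then have [measurable]: "{t. ereal r < ?\<alpha> t} \<in> sets borel"
    by (rule real_interval_borel_measurable)
  have "A = d z -` {t. ereal r < ?\<alpha> t} \<inter> space borel" by (auto simp: A_def m_def)
  then show A [measurable]: "A \<in> sets borel"
    using measurable_sets[OF lsc_metric_measurable[OF d] \<open>{t. ereal r < ?\<alpha> t} \<in> sets borel\<close>]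
    by (simp only:)
  show "measure \<mu> A \<le> exp (- r)"
  proof (cases "measure \<mu> A = 0")
    case False
    then have pos: "0 < measure \<mu> A" by (simp add: order_less_le)
    define \<nu> where "\<nu> = uniform_measure \<mu> A"
    have A\<mu>: "A \<in> sets \<mu>" using A sets by simp
    have em: "emeasure \<mu> A \<noteq> 0" using pos by (simp add: M.emeasure_eq_measure)
    interpret N: prob_space \<nu>
      unfolding \<nu>_def using em by (intro prob_space_uniform_measure) auto
    have "(\<integral>\<^sup>+ x. ennreal (d z x) \<partial>\<nu>) = (\<integral>\<^sup>+ x. ennreal (d z x) * indicator A x \<partial>\<mu>) / emeasure \<mu> A"
      unfolding \<nu>_def by (rule nn_integral_uniform_measure) (use A\<mu> in measurable)
    also have "(\<integral>\<^sup>+ x. ennreal (d z x) * indicator A x \<partial>\<mu>) \<le> (\<integral>\<^sup>+ x. ennreal (d z x) \<partial>\<mu>)"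
      by (intro nn_integral_mono) (auto simp: indicator_def)
    also have "\<dots> = ennreal m"
      unfolding m_def using finite_moment[OF d \<mu>] nn by (intro nn_integral_eq_integral) auto
    finally have "(\<integral>\<^sup>+ x. ennreal (d z x) \<partial>\<nu>) \<le> ennreal m / emeasure \<mu> A"
      by (auto intro: divide_right_mono_ennreal)
    also have "\<dots> < \<infinity>"
      using pos nn by (simp add: M.emeasure_eq_measure divide_ennreal m_def integral_nonneg_AE)
    finally have \<nu>: "\<nu> \<in> borel_probs_d d"
      using sets N.prob_space_axioms by (auto simp: borel_probs_d_def borel_probs_def \<nu>_def)
    define w where "w = (\<integral>x. d z x \<partial>\<nu>)"
    have "ereal r < ?\<alpha> w"
    proof (rule ccontr)
      assume "\<not> ?thesis"
      then have "w < d z x" if "x \<in> A" for x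
        using that \<alpha>_mono[of "d z x" w] unfolding A_def m_def[symmetric]
        by (metis (no_types, lifting) leI le_less_trans less_le_trans mem_Collect_eq not_le)
      then have "AE x in \<nu>. w < d z x"
        unfolding \<nu>_def by (intro AE_uniform_measureI[OF A\<mu>]) auto
      from N.expectation_greater[OF finite_moment[OF d \<nu>] this]
      show False by (simp add: w_def)
    qed
    also have "?\<alpha> w \<le> \<alpha> (enn2real (transport_cost d \<mu> \<nu>))"
      using integral_le_transport_cost[OF d \<mu> \<nu>, of z]
      by (intro mono_onD[OF \<alpha>]) (auto simp: w_def m_def)
    also have "\<dots> \<le> rel_entropy \<nu> \<mu>"
      using ineq \<nu> by (auto simp: transport_entropy_ineq_def)
    also have "\<dots> = ereal (- ln (measure \<mu> A))"
      unfolding \<nu>_def by (rule rel_entropy_uniform_measure[OF \<mu>' A\<mu> pos])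
    finally have "ln (measure \<mu> A) \<le> - r" by simp
    then show ?thesis using pos by (metis exp_le_cancel_iff exp_ln)
  qed simp
qed

text \<open>
  A discrete layer-cake estimate: on \<open>n < Z \<le> n + 1\<close> the exponential of \<open>v * Z\<close> is at most
  \<open>exp (v * (n + 1))\<close>, so the integral is dominated by a geometric series with ratio \<open>exp (v - 1)\<close>.
  The factor \<open>c\<close> stands inside the integral because \<open>Z\<close> itself is not assumed measurable, and
  the integral of a non-measurable function need not be homogeneous.
\<close>

lemma exp_moment_of_tail_bound:
  fixes Z :: "'a \<Rightarrow> ereal" and c v :: real
  assumes M: "prob_space M" and Z: "\<And>x. 0 \<le> Z x" and v: "0 \<le> v" "v < 1"
    and A [measurable]: "\<And>n::nat. {x. ereal (real n) < Z x} \<in> sets M"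
    and tail: "\<And>n::nat. measure M {x. ereal (real n) < Z x} \<le> exp (- real n)"
  shows "(\<integral>\<^sup>+ x. ennreal c * exp_ext (ereal v * Z x) \<partial>M) < \<infinity>"
proof -
  interpret prob_space M by fact
  let ?A = "\<lambda>n::nat. {x. ereal (real n) < Z x}"
  let ?e = "\<lambda>n::nat. ennreal (exp (v * (real n + 1)))"
  define S where "S x = 1 + (\<Sum>n. ?e n * indicator (?A n) x)" for x
  have [measurable]: "S \<in> borel_measurable M" unfolding S_def by measurable
  have layer: "exp_ext (ereal v * Z x) \<le> S x" for x
  proof -
    consider "Z x = 0" | z where "Z x = ereal z" "0 < z" | "Z x = \<infinity>"
      using Z[of x] by (cases "Z x") (auto simp: zero_ereal_def order_le_less)
    then show ?thesis
    proof cases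
      case 1
      then show ?thesis by (simp add: S_def exp_ext_def zero_ereal_def)
    next
      case 2
      define n where "n = nat (\<lceil>z\<rceil> - 1)"
      have n: "real n < z" "z \<le> real n + 1"
        using 2(2) unfolding n_def by linarith+
      have "exp_ext (ereal v * Z x) \<le> ?e n"
        using 2 n v by (auto simp: exp_ext_def intro!: ennreal_leI mult_left_mono)
      also have "\<dots> = (\<Sum>n\<in>{n}. ?e n * indicator (?A n) x)" using 2 n by simp
      also have "\<dots> \<le> (\<Sum>n. ?e n * indicator (?A n) x)" by (rule sum_le_suminf) auto
      also have "\<dots> \<le> S x" unfolding S_def by simp
      finally show ?thesis .
    next
      case 3
      \<comment> \<open>Every layer contributes at least 1, also for \<open>v = 0\<close>.\<close>
      have "\<not> summable (\<lambda>n. exp (v * (real n + 1)))"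
      proof
        assume "summable (\<lambda>n. exp (v * (real n + 1)))"
        then have "(\<lambda>n. exp (v * (real n + 1))) \<longlonglongrightarrow> 0" by (rule summable_LIMSEQ_zero)
        then have "1 \<le> (0::real)"
          by (rule LIMSEQ_le_const) (use v in auto)
        then show False by simp
      qed
      then have "(\<Sum>n. ?e n) = \<top>" by (intro summable_iff_suminf_neq_top) auto
      then show ?thesis using 3 by (simp add: S_def)
    qed
  qed
  have "(\<integral>\<^sup>+ x. S x \<partial>M) = 1 + (\<Sum>n. ?e n * emeasure M (?A n))"
    unfolding S_def
    by (simp add: nn_integral_add nn_integral_suminf nn_integral_cmult_indicator emeasure_space_1)
  also have "\<dots> \<le> 1 + (\<Sum>n. ennreal (exp v * exp (v - 1) ^ n))"
  proof (intro add_left_mono suminf_le)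
    fix n
    have "?e n * emeasure M (?A n) \<le> ?e n * ennreal (exp (- real n))"
      unfolding emeasure_eq_measure by (intro mult_left_mono ennreal_leI tail) auto
    also have "\<dots> = ennreal (exp (v * (real n + 1) + - real n))"
      by (simp only: exp_add ennreal_mult exp_ge_zero)
    also have "v * (real n + 1) + - real n = v + real n * (v - 1)" by (simp add: algebra_simps)
    also have "exp \<dots> = exp v * exp (v - 1) ^ n" by (simp add: exp_add exp_of_nat_mult)
    finally show "?e n * emeasure M (?A n) \<le> ennreal (exp v * exp (v - 1) ^ n)" .
  qed auto
  also have "\<dots> < \<infinity>"
  proof -
    have "summable (\<lambda>n. exp v * exp (v - 1) ^ n)"
      using v by (intro summable_mult summable_geometric) auto
    then have "(\<Sum>n. ennreal (exp v * exp (v - 1) ^ n)) \<noteq> \<top>"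
      by (rule ennreal_suminf_neq_top) simp
    then show ?thesis by (simp add: less_top[symmetric])
  qed
  finally have "(\<integral>\<^sup>+ x. S x \<partial>M) < \<infinity>" .
  then have fin: "ennreal c * (\<integral>\<^sup>+ x. S x \<partial>M) < \<infinity>" by (simp add: ennreal_mult_less_top)
  have "(\<integral>\<^sup>+ x. ennreal c * exp_ext (ereal v * Z x) \<partial>M) \<le> (\<integral>\<^sup>+ x. ennreal c * S x \<partial>M)"
    by (intro nn_integral_mono mult_left_mono layer) auto
  also have "\<dots> = ennreal c * (\<integral>\<^sup>+ x. S x \<partial>M)" by (rule nn_integral_cmult) measurable
  finally show ?thesis using fin by (rule le_less_trans)
qed

text \<open>
  Half the distance to \<open>z\<close> is at most the midpoint of \<open>max 0 (d z x - m)\<close> and \<open>m\<close>, where \<open>m\<close> is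
  the mean distance.  Convexity therefore bounds \<open>u * \<alpha> (d z x / 2)\<close> by \<open>u / 2\<close> times
  \<open>\<alpha> (max 0 (d z x - m))\<close> plus a finite constant, and \<open>u / 2 < 1\<close> is the range in which the
  exponential tail bound gives a finite exponential moment.
\<close>

lemma transport_inequality_imp_exp_moment:
  fixes d :: "'a::polish_space \<Rightarrow> 'a \<Rightarrow> real"
  assumes d: "lsc_metric d" and \<mu>: "\<mu> \<in> borel_probs_d d"
    and \<alpha>: "\<alpha> \<in> class_C" and ineq: "transport_entropy_ineq d \<mu> \<alpha>"
    and fin: "\<alpha> (\<integral>x. d z x \<partial>\<mu>) < \<infinity>" and u: "0 \<le> u" "u < 2"
  shows "(\<integral>\<^sup>+ x. exp_ext (ereal u * \<alpha> (d z x / 2)) \<partial>\<mu>) < \<infinity>"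
proof -
  define m where "m = (\<integral>x. d z x \<partial>\<mu>)"
  have \<mu>': "prob_space \<mu>" and sets: "sets \<mu> = sets borel"
    using \<mu> by (auto simp: borel_probs_d_def borel_probs_def)
  have nn: "0 \<le> d z x" for x
    by (rule lsc_metric_nonneg[OF d])
  have m: "0 \<le> m" unfolding m_def by (rule integral_nonneg_AE) (simp add: nn)
  have \<alpha>nn: "\<And>t. 0 \<le> t \<Longrightarrow> 0 \<le> \<alpha> t" and mono: "mono_on {0..} \<alpha>"
    and cvx: "\<And>s t l. 0 \<le> s \<Longrightarrow> 0 \<le> t \<Longrightarrow> l \<in> {0..1} \<Longrightarrow>
        \<alpha> ((1 - l) * s + l * t) \<le> ereal (1 - l) * \<alpha> s + ereal l * \<alpha> t"
    using \<alpha> by (auto simp: class_C_def)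
  obtain k where k: "\<alpha> m = ereal k"
    using fin \<alpha>nn[OF m] unfolding m_def[symmetric] by (cases "\<alpha> m") auto
  define Z where "Z x = \<alpha> (max 0 (d z x - m))" for x
  have Z: "0 \<le> Z x" for x unfolding Z_def by (rule \<alpha>nn) simp
  note dev = transport_inequality_imp_deviation[OF d \<mu> mono ineq, where z = z, folded m_def, folded Z_def]
  have ptw: "exp_ext (ereal u * \<alpha> (d z x / 2)) \<le> ennreal (exp (u * k / 2)) * exp_ext (ereal (u / 2) * Z x)" for x
  proof -
    have "\<alpha> (d z x / 2) \<le> \<alpha> ((1 - 1 / 2) * max 0 (d z x - m) + 1 / 2 * m)"
      using m nn[of x] by (intro mono_onD[OF mono]) (auto simp: max_def field_simps)
    also have "\<dots> \<le> ereal (1 - 1 / 2) * Z x + ereal (1 / 2) * \<alpha> m"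
      unfolding Z_def using m by (intro cvx) auto
    finally have le: "\<alpha> (d z x / 2) \<le> ereal (1 / 2) * Z x + ereal (k / 2)" by (simp add: k)
    show ?thesis
    proof (cases "Z x")
      case (real y)
      with le \<alpha>nn[of "d z x / 2"] nn[of x] obtain y' where y': "\<alpha> (d z x / 2) = ereal y'" "y' \<le> y / 2 + k / 2"
        by (cases "\<alpha> (d z x / 2)") auto
      have "u * y' \<le> u * (y / 2 + k / 2)" using y'(2) u(1) by (rule mult_left_mono)
      then have "exp (u * y') \<le> exp (u * k / 2) * exp (u / 2 * y)"
        unfolding exp_add[symmetric] by (simp add: algebra_simps)
      then show ?thesis
        by (simp add: y' real exp_ext_def ennreal_leI flip: ennreal_mult)
    next
      case PInf
      show ?thesis
      proof (cases "u = 0")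
        case True
        then show ?thesis by (simp flip: zero_ereal_def)
      next
        case False
        then have "exp_ext (ereal (u / 2) * Z x) = \<infinity>" using PInf u by (simp add: exp_ext_def)
        then show ?thesis by (simp add: ennreal_mult_top)
      qed
    qed (use Z[of x] in simp)
  qed
  have "(\<integral>\<^sup>+ x. exp_ext (ereal u * \<alpha> (d z x / 2)) \<partial>\<mu>)
      \<le> (\<integral>\<^sup>+ x. ennreal (exp (u * k / 2)) * exp_ext (ereal (u / 2) * Z x) \<partial>\<mu>)"
    by (intro nn_integral_mono ptw)
  also have "\<dots> < \<infinity>"
    using u dev sets by (intro exp_moment_of_tail_bound[OF \<mu>' Z]) auto
  finally show ?thesis .
qed

theorem theorem5p19:
  fixes d :: "'a::polish_space \<Rightarrow> 'a \<Rightarrow> real" and \<mu> :: "'a measure"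
  assumes "lsc_metric d"
    and "\<mu> \<in> borel_probs_d d"
  shows
    "(\<forall>(a::real) (B::real) \<gamma>.
        0 \<le> a \<longrightarrow>
        (\<exists>xo. (\<integral>\<^sup>+ x. ennreal (exp (a * d xo x)) \<partial>\<mu>) \<le> 2) \<longrightarrow>
        \<gamma> \<in> class_C \<longrightarrow>
        (\<exists>x1. (\<integral>\<^sup>+ x. exp_ext (\<gamma> (d x1 x)) \<partial>\<mu>) \<le> ennreal B) \<longrightarrow>
        transport_entropy_ineq d \<mu>
          (\<lambda>t. max (ereal ((sqrt (a * t + 1) - 1)\<^sup>2)) (2 * \<gamma> (t / 2) - ereal (2 * ln B))))
     \<and>
     (\<forall>\<alpha>\<in>class_C.
        transport_entropy_ineq d \<mu> \<alpha> \<longrightarrow>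
        (\<forall>xs. \<alpha> (\<integral>x. d xs x \<partial>\<mu>) < \<infinity> \<longrightarrow>
          (\<forall>u::real. 0 \<le> u \<and> u < 2 \<longrightarrow>
            (\<integral>\<^sup>+ x. exp_ext (ereal u * \<alpha> (d xs x / 2)) \<partial>\<mu>) < \<infinity>)))"
proof (intro conjI allI impI ballI)
  fix a B :: real and \<gamma>
  assume a: "0 \<le> a" and "\<exists>xo. (\<integral>\<^sup>+ x. ennreal (exp (a * d xo x)) \<partial>\<mu>) \<le> 2"
    and \<gamma>: "\<gamma> \<in> class_C" and "\<exists>x1. (\<integral>\<^sup>+ x. exp_ext (\<gamma> (d x1 x)) \<partial>\<mu>) \<le> ennreal B"
  then obtain xo x1 where
    xo: "(\<integral>\<^sup>+ x. ennreal (exp (a * d xo x)) \<partial>\<mu>) \<le> 2" and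
    x1: "(\<integral>\<^sup>+ x. exp_ext (\<gamma> (d x1 x)) \<partial>\<mu>) \<le> ennreal B" by blast
  show "transport_entropy_ineq d \<mu>
      (\<lambda>t. max (ereal ((sqrt (a * t + 1) - 1)\<^sup>2)) (2 * \<gamma> (t / 2) - ereal (2 * ln B)))"
    unfolding transport_entropy_ineq_def
    using transport_inequality_quadratic_linear[OF assms _ a xo]
      transport_inequality_convex[OF assms _ \<gamma> x1]
    by (intro ballI max.boundedI) auto
next
  fix \<alpha> xs and u :: real
  assume "\<alpha> \<in> class_C" "transport_entropy_ineq d \<mu> \<alpha>" "\<alpha> (\<integral>x. d xs x \<partial>\<mu>) < \<infinity>" "0 \<le> u \<and> u < 2"
  then show "(\<integral>\<^sup>+ x. exp_ext (ereal u * \<alpha> (d xs x / 2)) \<partial>\<mu>) < \<infinity>"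
    by (intro transport_inequality_imp_exp_moment[OF assms]) auto
qed

end
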